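(* Let $K$ be a field, let $E$ be an arbitrary directed graph, and let $L=L_K(E)$ be the Leavitt path algebra of $E$ over $K$. If $A,B,C$ are any (two-sided) ideals of $L$, then $$A(B\cap C)=AB\cap AC.$$
   Context: Directed graph: $E=(E^0,E^1,r,s)$ consists of two countable sets $E^0$ (vertices) and $E^1$ (edges) and functions $r,s:E^1\to E^0$ (range and source). A vertex $v$ is regular if $s^{-1}(v)$ is non-empty and finite. Leavitt path algebra: $L_K(E)$ is the (associative, not necessarily unital) $K$-algebra generated by $E^0\cup E^1\cup\{e^*: e\in E^1\}$ subject to the relations - $vw=\delta_{v,w}v$ for $v,w\in E^0$; - $s(e)e=e=e\,r(e)$ and $r(e)e^*=e^*=e^*s(e)$ for $e\in E^1$; - (CK1) $e^*f=\delta_{e,f}\,r(f)$ for $e,f\in E^1$; - (CK2) $v=\sum_{e\in s^{-1}(v)}ee^*$ for every regular vertex $v$. Ideals are two-sided, and the product $AB$ of ideals is the set of finite sums of elements $ab$ with $a\in A$, $b\in B$. *)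

theory Defs
  imports "HOL-Algebra.QuotRing" "HOL-Algebra.Ideal_Product" "HOL-Algebra.Module"
    "HOL-Library.Poly_Mapping" "HOL-Library.Countable_Set" "Graph_Theory.Digraph"
begin

section \<open>Algebras without unit\<close>

text \<open>
  Algebras are records of type \<^typ>\<open>('k, 'a) module\<close>; multiplication need not have a unit, and the
  record field \<^const>\<open>one\<close> carries no meaning and is never used. The locales \<^locale>\<open>ring\<close> and
  \<^locale>\<open>ideal\<close> presuppose a unit, hence the following notion.
\<close>

definition two_sided_ideal :: "'a set \<Rightarrow> ('a, 'm) ring_scheme \<Rightarrow> bool" where
  "two_sided_ideal I R \<longleftrightarrow> additive_subgroup I R \<and>
     (\<forall>a\<in>I. \<forall>x\<in>carrier R. x \<otimes>\<^bsub>R\<^esub> a \<in> I \<and> a \<otimes>\<^bsub>R\<^esub> x \<in> I)"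

text \<open>Ideals that are also linear subspaces; without a unit this is not automatic.\<close>

definition algebra_ideal :: "'a set \<Rightarrow> ('k, 'a) module \<Rightarrow> bool" where
  "algebra_ideal I R \<longleftrightarrow> two_sided_ideal I R \<and> (\<forall>c. \<forall>a\<in>I. c \<odot>\<^bsub>R\<^esub> a \<in> I)"

definition algebra_ideal_generated :: "('k, 'a) module \<Rightarrow> 'a set \<Rightarrow> 'a set" where
  "algebra_ideal_generated R S = \<Inter>{I. algebra_ideal I R \<and> S \<subseteq> I}"

definition quotient_algebra :: "('k, 'a) module \<Rightarrow> 'a set \<Rightarrow> ('k, 'a set) module" where
  "quotient_algebra R I =
     ring.extend (R Quot I) (module.fields (\<lambda>c X. \<Union>x\<in>X. I +>\<^bsub>R\<^esub> (c \<odot>\<^bsub>R\<^esub> x)))"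

section \<open>Free algebras\<close>

text \<open>
  The free associative algebra without unit on a set \<open>X\<close> over a field: linear combinations of
  nonempty words in \<open>X\<close>, multiplied by extending concatenation bilinearly.
\<close>

definition free_mult ::
  "('g list \<Rightarrow>\<^sub>0 'k::field) \<Rightarrow> ('g list \<Rightarrow>\<^sub>0 'k) \<Rightarrow> ('g list \<Rightarrow>\<^sub>0 'k)" where
  "free_mult p q =
     (\<Sum>u\<in>Poly_Mapping.keys p. \<Sum>w\<in>Poly_Mapping.keys q.
        Poly_Mapping.single (u @ w) (Poly_Mapping.lookup p u * Poly_Mapping.lookup q w))"

definition free_algebra :: "'g set \<Rightarrow> ('k::field, 'g list \<Rightarrow>\<^sub>0 'k) module" where
  "free_algebra X =
     \<lparr>carrier = {p. \<forall>w\<in>Poly_Mapping.keys p. w \<noteq> [] \<and> set w \<subseteq> X},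
      mult = free_mult, one = 0, zero = 0, add = (+),
      smult = (\<lambda>c. Poly_Mapping.map ((*) c))\<rparr>"

abbreviation word :: "'g list \<Rightarrow> ('g list \<Rightarrow>\<^sub>0 'k::field)" where
  "word w \<equiv> Poly_Mapping.single w 1"

section \<open>Leavitt path algebras\<close>

text \<open>
  In the library's digraphs, \<^const>\<open>tail\<close> is the source map \<open>s\<close>, \<^const>\<open>head\<close> is the range map \<open>r\<close>
  and \<^term>\<open>out_arcs E v\<close> is \<open>s\<^sup>-\<^sup>1(v)\<close>. Loops and parallel edges are allowed.
\<close>

locale countable_digraph = wf_digraph E for E (structure) +
  assumes countable_verts: "countable (verts E)"
    and countable_arcs: "countable (arcs E)"

definition regular_vertex :: "('v, 'e) pre_digraph \<Rightarrow> 'v \<Rightarrow> bool" where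
  "regular_vertex E v \<longleftrightarrow> v \<in> verts E \<and> out_arcs E v \<noteq> {} \<and> finite (out_arcs E v)"

datatype ('v, 'e) lpa_gen = Vertex 'v | Edge 'e | Ghost 'e

definition lpa_gens :: "('v, 'e) pre_digraph \<Rightarrow> ('v, 'e) lpa_gen set" where
  "lpa_gens E = Vertex ` verts E \<union> Edge ` arcs E \<union> Ghost ` arcs E"

text \<open>A defining relation \<open>p = q\<close> is encoded as the element \<open>p - q\<close>.\<close>

definition lpa_relators ::
  "('v, 'e) pre_digraph \<Rightarrow> (('v, 'e) lpa_gen list \<Rightarrow>\<^sub>0 'k::field) set" where
  "lpa_relators E =
     {word [Vertex v, Vertex w] - (if v = w then word [Vertex v] else 0) | v w.
        v \<in> verts E \<and> w \<in> verts E}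
   \<union> {word [Vertex (tail E e), Edge e] - word [Edge e] | e. e \<in> arcs E}
   \<union> {word [Edge e, Vertex (head E e)] - word [Edge e] | e. e \<in> arcs E}
   \<union> {word [Vertex (head E e), Ghost e] - word [Ghost e] | e. e \<in> arcs E}
   \<union> {word [Ghost e, Vertex (tail E e)] - word [Ghost e] | e. e \<in> arcs E}
   \<union> {word [Ghost e, Edge f] - (if e = f then word [Vertex (head E f)] else 0) | e f.
        e \<in> arcs E \<and> f \<in> arcs E}
   \<union> {word [Vertex v] - (\<Sum>e\<in>out_arcs E v. word [Edge e, Ghost e]) | v. regular_vertex E v}"

definition leavitt_path_algebra ::
  "('v, 'e) pre_digraph \<Rightarrow> ('k::field, (('v, 'e) lpa_gen list \<Rightarrow>\<^sub>0 'k) set) module" where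
  "leavitt_path_algebra E =
     quotient_algebra (free_algebra (lpa_gens E))
       (algebra_ideal_generated (free_algebra (lpa_gens E)) (lpa_relators E))"

end

theory Submission
  imports Defs
begin

text \<open>
  Products with a flat right ideal commute with intersections of left ideals, and every right ideal
  of a Leavitt path algebra is flat. By the equational criterion, flatness means that for a row \<open>a\<close> and
  a column \<open>r\<close> over \<open>L\<close> with \<open>a * r = 0\<close> there is a square matrix \<open>T\<close> with \<open>a * T = a\<close> and
  \<open>T * r = 0\<close>. If \<open>x = \<Sum> a\<^sub>i * b\<^sub>i = \<Sum> a'\<^sub>j * c\<^sub>j\<close> lies in \<open>A * B\<close> and in \<open>A * C\<close>, apply this to the row of
  all \<open>a\<^sub>i\<close>, \<open>a'\<^sub>j\<close> and the column of all \<open>b\<^sub>i\<close>, \<open>- c\<^sub>j\<close>: the part of \<open>T * r\<close> that comes from the \<open>b\<^sub>i\<close> lies in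
  \<open>B \<inter> C\<close>, and its product with the row is \<open>x\<close>.

  Only finitely many edges occur in a relation. The corresponding subalgebra contains the path
  algebra of a finite graph (vertices that emit further edges are split in two), and multiplication
  by long paths moves any of its elements into the path algebra. Paths are words,
  and right ideals of free algebras are free by a comparison of leading words. The paths are linearly
  independent in \<open>L\<close> because \<open>L\<close> acts on a set by partial injections that are graded by path length.
\<close>

section \<open>Free algebras on words\<close>

text \<open>The ghost edges can be absorbed without loss. By (CK2), the sum of the vertices of a
  finite graph equals the sum of all \<open>p p*\<close>, where \<open>p\<close> runs over the paths
  of length \<open>n\<close> and the shorter paths that end in a sink. So the row of all
  \<open>a p\<close> determines \<open>a\<close>, and for large \<open>n\<close> it is free of ghost
  edges. Write this row as a basis row \<open>d\<close> times a matrix \<open>\<sigma>\<close>, and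
  \<open>d\<close> as this row times a matrix \<open>g\<close>. Then \<open>T\<close> is the product
  of the matrices with entries \<open>p g\<close> and \<open>\<sigma> p*\<close>. The relation
  \<open>a r = 0\<close> says that \<open>d\<close> annihilates the column
  \<open>\<sigma> p* r\<close>, so this column vanishes because \<open>d\<close> is a basis. Two
  obstacles shape the setting. (CK2) involves all edges that leave a vertex, while a relation
  mentions only some of them; this is why vertices are split. And \<open>L\<close> may lack a unit:
  computations take place in a free algebra with unit, modulo an extension of the ideal of
  relations, and the sum of the vertices of the finite graph serves as a local unit that differs
  from \<open>1\<close>.\<close>

instantiation list :: (type) monoid_add
begin

text \<open>Finitely supported functions multiply by convolution over an additive monoid. With
  concatenation as addition they form the free algebra with unit, the empty word being
  \<open>1\<close>.\<close>

definition zero_list :: "'a list" where "zero_list = []"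

definition plus_list :: "'a list \<Rightarrow> 'a list \<Rightarrow> 'a list" where "plus_list = append"

instance by standard (simp_all add: zero_list_def plus_list_def)

end

abbreviation keys where "keys \<equiv> Poly_Mapping.keys"
abbreviation lookup where "lookup \<equiv> Poly_Mapping.lookup"
abbreviation single where "single \<equiv> Poly_Mapping.single"

text \<open>\<open>\<phi>\<close> receives the coefficient together with the word, so the target
  needs no scalar action.\<close>

definition linear_ext ::
  "('x \<Rightarrow> 'k::zero \<Rightarrow> 'r::comm_monoid_add) \<Rightarrow> ('x \<Rightarrow>\<^sub>0 'k) \<Rightarrow> 'r" where
  "linear_ext \<phi> f = (\<Sum>w\<in>keys f. \<phi> w (lookup f w))"

lemma poly_mapping_sum_single: "f = (\<Sum>w\<in>keys f. single w (lookup f w))"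
  by (rule poly_mapping_eqI) (auto simp: lookup_sum lookup_single when_def in_keys_iff)

lemma poly_mapping_single_induct [case_names zero add]:
  fixes f :: "'x \<Rightarrow>\<^sub>0 'k::comm_monoid_add"
  assumes "P 0"
    and "\<And>w f'. w \<in> keys f \<Longrightarrow> keys f' \<subseteq> keys f \<Longrightarrow> P f' \<Longrightarrow> P (single w (lookup f w) + f')"
  shows "P f"
proof -
  have "P (\<Sum>w\<in>A. single w (lookup f w)) \<and> keys (\<Sum>w\<in>A. single w (lookup f w)) \<subseteq> A"
    if "finite A" "A \<subseteq> keys f" for A
    using that
  proof (induction A rule: finite_induct)
    case empty
    then show ?case using assms(1) by simp
  next
    case (insert x A)
    let ?g = "\<Sum>w\<in>A. single w (lookup f w)"
    have "P (single x (lookup f x) + ?g)"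
      using insert by (intro assms(2)) auto
    moreover have "keys (single x (lookup f x) + ?g) \<subseteq> insert x A"
      using insert keys_add[of "single x (lookup f x)" ?g] by (auto split: if_splits)
    ultimately show ?case using insert by simp
  qed
  from this[of "keys f"] show ?thesis using poly_mapping_sum_single[of f] by simp
qed

context
  fixes \<phi> :: "'x \<Rightarrow> 'k::ab_group_add \<Rightarrow> 'r::ab_group_add"
  assumes additive: "\<And>w a b. \<phi> w (a + b) = \<phi> w a + \<phi> w b"
begin

lemma additive_zero: "\<phi> w 0 = 0"
  using additive[of w 0 0] by simp

lemma linear_ext_superset:
  "finite S \<Longrightarrow> keys f \<subseteq> S \<Longrightarrow> linear_ext \<phi> f = (\<Sum>w\<in>S. \<phi> w (lookup f w))"
  unfolding linear_ext_def
  by (rule sum.mono_neutral_left) (auto simp: in_keys_iff additive_zero)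

lemma linear_ext_zero: "linear_ext \<phi> 0 = 0"
  by (simp add: linear_ext_def)

lemma linear_ext_single: "linear_ext \<phi> (single w c) = \<phi> w c"
  by (simp add: linear_ext_def additive_zero)

lemma linear_ext_add: "linear_ext \<phi> (f + g) = linear_ext \<phi> f + linear_ext \<phi> g"
proof -
  have "linear_ext \<phi> h = (\<Sum>w\<in>keys f \<union> keys g. \<phi> w (lookup h w))"
    if "h \<in> {f, g, f + g}" for h
    using that keys_add[of f g] by (intro linear_ext_superset) auto
  then show ?thesis by (simp add: sum.distrib lookup_add additive)
qed

lemma linear_ext_uminus: "linear_ext \<phi> (- f) = - linear_ext \<phi> f"
  using linear_ext_add[of f "- f"] by (simp add: linear_ext_zero eq_neg_iff_add_eq_0 add.commute)

lemma linear_ext_diff: "linear_ext \<phi> (f - g) = linear_ext \<phi> f - linear_ext \<phi> g"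
  using linear_ext_add[of f "- g"] by (simp add: linear_ext_uminus)

lemma linear_ext_sum: "linear_ext \<phi> (\<Sum>i\<in>I. f i) = (\<Sum>i\<in>I. linear_ext \<phi> (f i))"
  by (induction I rule: infinite_finite_induct) (simp_all add: linear_ext_zero linear_ext_add)

end

lemma mult_eq_sum_single:
  fixes f g :: "'x list \<Rightarrow>\<^sub>0 'k::ring_1"
  shows "f * g = (\<Sum>u\<in>keys f. \<Sum>w\<in>keys g. single (u @ w) (lookup f u * lookup g w))"
proof -
  have "f * g = (\<Sum>u\<in>keys f. single u (lookup f u)) * (\<Sum>w\<in>keys g. single w (lookup g w))"
    using poly_mapping_sum_single[of f] poly_mapping_sum_single[of g] by simp
  then show ?thesis by (simp add: sum_product mult_single plus_list_def)
qed

lemma linear_ext_mult: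
  fixes \<phi> :: "'x list \<Rightarrow> 'k::ring_1 \<Rightarrow> 'r::ring"
  assumes additive: "\<And>w a b. \<phi> w (a + b) = \<phi> w a + \<phi> w b"
    and mult: "\<And>u w a b. \<phi> (u @ w) (a * b) = \<phi> u a * \<phi> w b"
  shows "linear_ext \<phi> (f * g) = linear_ext \<phi> f * linear_ext \<phi> g"
proof -
  have "linear_ext \<phi> (f * g) = (\<Sum>u\<in>keys f. \<Sum>w\<in>keys g. \<phi> u (lookup f u) * \<phi> w (lookup g w))"
    unfolding mult_eq_sum_single[of f g]
    by (simp add: linear_ext_sum[of \<phi>, OF additive] linear_ext_single[of \<phi>, OF additive] mult)
  then show ?thesis by (simp add: linear_ext_def sum_product)
qed

lemma keys_mult_words:
  fixes f g :: "'x list \<Rightarrow>\<^sub>0 'k::ring_1"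
  assumes "w \<in> keys (f * g)"
  obtains u v where "u \<in> keys f" "v \<in> keys g" "w = u @ v"
  using assms keys_mult[of f g] by (auto simp: plus_list_def)

section \<open>Right ideals of free algebras\<close>

text \<open>Compatibility on both sides makes the leading word of a product the concatenation of the
  leading words. The plain lexicographic order violates \<open>append_both\<close>: a prefix
  precedes its extension, but letters appended to both can reverse this.\<close>

locale word_order =
  fixes less :: "('x list \<times> 'x list) set"
  assumes wf: "wf less" and trans: "trans less" and total: "total less"
    and append_left: "(v, w) \<in> less \<Longrightarrow> (u @ v, u @ w) \<in> less"
    and append_both: "(u, u') \<in> less \<Longrightarrow> (w, w') \<in> less\<^sup>= \<Longrightarrow> (u @ w, u' @ w') \<in> less"
begin

lemma asym: "(u, w) \<in> less \<Longrightarrow> (w, u) \<notin> less"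
  by (rule wf_not_sym[OF wf])

lemma irrefl: "(w, w) \<notin> less"
  using asym by blast

definition leading :: "('x list \<Rightarrow>\<^sub>0 'k::field) \<Rightarrow> 'x list \<Rightarrow> bool" where
  "leading f w \<longleftrightarrow> w \<in> keys f \<and> (\<forall>u\<in>keys f. (u, w) \<in> less\<^sup>=)"

lemma finite_has_max:
  assumes "finite A" "A \<noteq> {}"
  shows "\<exists>w\<in>A. \<forall>u\<in>A. (u, w) \<in> less\<^sup>="
  using assms
proof (induction A rule: finite_ne_induct)
  case (insert x A)
  then obtain w where w: "w \<in> A" "\<forall>u\<in>A. (u, w) \<in> less\<^sup>=" by blast
  show ?case
  proof (cases "(x, w) \<in> less\<^sup>=")
    case False
    then have "(w, x) \<in> less" using total by (auto simp: total_on_def)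
    then show ?thesis using w trans by (auto dest: transD)
  qed (use w in auto)
qed simp

lemma leading_exists: "f \<noteq> 0 \<Longrightarrow> \<exists>w. leading f w"
  using finite_has_max[of "keys f"] unfolding leading_def by auto

text \<open>A strict comparison of the first factors would make the concatenations differ. Hence the
  top word of a product arises from a single pair of words and cannot cancel.\<close>

lemma append_mono_eq:
  assumes "(u, u') \<in> less\<^sup>=" "(w, w') \<in> less\<^sup>=" "u @ w = u' @ w'"
  shows "u = u' \<and> w = w'"
  using assms append_left append_both irrefl by (metis Un_iff pair_in_Id_conv same_append_eq)

lemma append_mono:
  assumes "(u, u') \<in> less\<^sup>=" "(w, w') \<in> less\<^sup>="
  shows "(u @ w, u' @ w') \<in> less\<^sup>="
  using assms append_left append_both by auto

lemma lookup_mult_leading: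
  assumes "leading f u" "leading g w"
  shows "lookup (f * g) (u @ w) = lookup f u * lookup g w"
proof -
  have "lookup (f * g) (u @ w) =
      (\<Sum>(u', w')\<in>keys f \<times> keys g. lookup (single (u' @ w') (lookup f u' * lookup g w')) (u @ w))"
    by (simp add: mult_eq_sum_single[of f g] lookup_sum sum.cartesian_product split_def)
  also have "\<dots> = (\<Sum>p\<in>keys f \<times> keys g. if p = (u, w) then lookup f u * lookup g w else 0)"
  proof (rule sum.cong[OF refl], clarify)
    fix u' w' assume "u' \<in> keys f" "w' \<in> keys g"
    then have "(u', u) \<in> less\<^sup>=" "(w', w) \<in> less\<^sup>=" using assms unfolding leading_def by auto
    then have "u' @ w' = u @ w \<longleftrightarrow> u' = u \<and> w' = w" using append_mono_eq by blast
    then show "lookup (single (u' @ w') (lookup f u' * lookup g w')) (u @ w) =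
        (if (u', w') = (u, w) then lookup f u * lookup g w else 0)"
      by (auto simp: lookup_single when_def)
  qed
  also have "\<dots> = lookup f u * lookup g w"
    using assms by (subst sum.delta) (auto simp: leading_def)
  finally show ?thesis .
qed

lemma leading_mult:
  assumes "leading f u" "leading g w"
  shows "leading (f * g) (u @ w)"
  unfolding leading_def
proof (intro conjI ballI)
  show "u @ w \<in> keys (f * g)"
    using assms lookup_mult_leading[OF assms] by (auto simp: leading_def in_keys_iff)
next
  fix v assume "v \<in> keys (f * g)"
  then obtain u' w' where "u' \<in> keys f" "w' \<in> keys g" "v = u' @ w'" by (rule keys_mult_words)
  then show "(v, u @ w) \<in> less\<^sup>="
    using assms append_mono unfolding leading_def by auto
qed

text \<open>Distinct members have leading words that are not prefixes of each other, so the leading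
  words of the summands of \<open>\<Sum>d\<in>D. d * x d\<close> cannot cancel.\<close>

lemma prefix_free_independent:
  fixes D :: "('x list \<Rightarrow>\<^sub>0 'k::field) set"
  assumes "finite D" and lead: "\<And>d. d \<in> D \<Longrightarrow> leading d (l d)"
    and prefix_free: "\<And>c d t. c \<in> D \<Longrightarrow> d \<in> D \<Longrightarrow> l d = l c @ t \<Longrightarrow> c = d"
    and sum: "(\<Sum>d\<in>D. d * x d) = 0" and "d \<in> D"
  shows "x d = 0"
proof (rule ccontr)
  assume "x d \<noteq> 0"
  define N where "N = {d\<in>D. x d \<noteq> 0}"
  have N: "finite N" "N \<noteq> {}" using \<open>finite D\<close> \<open>d \<in> D\<close> \<open>x d \<noteq> 0\<close> by (auto simp: N_def)
  have "\<forall>d\<in>N. \<exists>w. leading (x d) w" using leading_exists by (auto simp: N_def)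
  then obtain m where m: "\<And>d. d \<in> N \<Longrightarrow> leading (x d) (m d)" by metis
  define p where "p d = l d @ m d" for d
  have p: "leading (d * x d) (p d)" if "d \<in> N" for d
    unfolding p_def using that by (intro leading_mult lead m) (auto simp: N_def)
  \<comment> \<open>If \<open>l c @ m c\<close> and \<open>l d @ m d\<close> agree, one of
    \<open>l c\<close>, \<open>l d\<close> is a prefix of the other.\<close>
  have inj: "c = d" if "c \<in> N" "d \<in> N" "p c = p d" for c d
  proof -
    from that(3) obtain t where "l c = l d @ t \<or> l d = l c @ t"
      unfolding p_def append_eq_append_conv2 by metis
    then show ?thesis using that prefix_free[of c d t] prefix_free[of d c t] by (auto simp: N_def)
  qed
  \<comment> \<open>The largest word \<open>p d\<close> occurs in the summand of \<open>d\<close>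
    alone, since the other summands are led by strictly smaller words.\<close>
  obtain d where d: "d \<in> N" "\<And>c. c \<in> N \<Longrightarrow> (p c, p d) \<in> less\<^sup>="
    using finite_has_max[of "p ` N"] N by auto
  have others: "lookup (c * x c) (p d) = 0" if "c \<in> D - {d}" for c
  proof (cases "c \<in> N")
    case True
    then have "(p c, p d) \<in> less" using d that inj by blast
    then have "p d \<notin> keys (c * x c)"
      using p[OF True] asym unfolding leading_def by (metis UnE irrefl pair_in_Id_conv)
    then show ?thesis by (simp add: in_keys_iff)
  qed (use that in \<open>auto simp: N_def\<close>)
  have "0 = lookup (\<Sum>c\<in>D. c * x c) (p d)" using sum by simp
  also have "\<dots> = lookup (d * x d) (p d) + (\<Sum>c\<in>D - {d}. lookup (c * x c) (p d))"
    unfolding lookup_sum using d \<open>finite D\<close> by (intro sum.remove) (auto simp: N_def)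
  also have "\<dots> = lookup (d * x d) (p d)" using others by simp
  also have "\<dots> \<noteq> 0" using p[OF d(1)] by (simp add: leading_def in_keys_iff)
  finally show False by simp
qed

end

text \<open>Words are compared by length first and then lexicographically, for a well-order of the
  possibly infinite alphabet.\<close>

lemma word_order_exists: "\<exists>less :: ('x list \<times> 'x list) set. word_order less"
proof -
  obtain r :: "('x \<times> 'x) set" where r: "well_order_on UNIV r"
    using well_ordering by metis
  define s where "s = r - Id"
  have s: "wf s" "trans s" "total s" "irrefl s"
    using r unfolding well_order_on_def linear_order_on_def partial_order_on_def preorder_on_def s_def
    by (auto simp: total_on_def irrefl_def intro: trans_diff_Id)
  have "word_order (lenlex s)"
  proof
    show "wf (lenlex s)" "trans (lenlex s)" "total (lenlex s)"
      using s by (auto intro: total_lenlex)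
    show "(u @ v, u @ w) \<in> lenlex s" if "(v, w) \<in> lenlex s" for u v w
      using that lenlex_append2[OF s(4)] by blast
    show "(u @ w, u' @ w') \<in> lenlex s" if "(u, u') \<in> lenlex s" "(w, w') \<in> (lenlex s)\<^sup>=" for u u' w w'
    proof (cases "length w = length w'")
      case True
      then show ?thesis using that lenlex_append1 by blast
    next
      case False
      \<comment> \<open>Here \<open>w\<close> is shorter than \<open>w'\<close> and \<open>u\<close>
        is not longer than \<open>u'\<close>, so the lengths decide.\<close>
      then show ?thesis using that lenlex_length[of u u' s] lenlex_length[of w w' s]
        by (auto simp: lenlex_conv)
    qed
  qed
  then show ?thesis by blast
qed

section \<open>Right spans and bases of right ideals\<close>

definition right_span :: "'r::ring_1 set \<Rightarrow> 'r set" where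
  "right_span D = {\<Sum>d\<in>D'. d * x d | D' x. finite D' \<and> D' \<subseteq> D}"

text \<open>Coefficients are padded with \<open>0\<close> so that finitely many combinations share
  one index set and can be read as a matrix.\<close>

lemma right_span_common:
  assumes "finite A" "A \<subseteq> right_span D"
  obtains D' x where "finite D'" "D' \<subseteq> D" "\<forall>a\<in>A. a = (\<Sum>d\<in>D'. d * x a d)"
proof -
  have "\<forall>a\<in>A. \<exists>D' x. finite D' \<and> D' \<subseteq> D \<and> a = (\<Sum>d\<in>D'. d * x d)"
  proof
    fix a assume "a \<in> A"
    then have "a \<in> right_span D" using assms(2) by blast
    then show "\<exists>D' x. finite D' \<and> D' \<subseteq> D \<and> a = (\<Sum>d\<in>D'. d * x d)"
      unfolding right_span_def by blast
  qed
  then obtain E y where E: "\<And>a. a \<in> A \<Longrightarrow> finite (E a) \<and> E a \<subseteq> D \<and> a = (\<Sum>d\<in>E a. d * y a d)"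
    by metis
  show ?thesis
  proof (rule that[of "\<Union>(E ` A)" "\<lambda>a d. if d \<in> E a then y a d else 0"]; (intro ballI)?)
    show "finite (\<Union>(E ` A))" "\<Union>(E ` A) \<subseteq> D" using assms(1) E by auto
    fix a assume a: "a \<in> A"
    have "a = (\<Sum>d\<in>E a. d * y a d)" using E a by blast
    also have "\<dots> = (\<Sum>d\<in>\<Union>(E ` A). d * (if d \<in> E a then y a d else 0))"
      using a assms(1) E by (intro sum.mono_neutral_cong_left) auto
    finally show "a = (\<Sum>d\<in>\<Union>(E ` A). d * (if d \<in> E a then y a d else 0))" .
  qed
qed

lemma right_span_base: "d \<in> D \<Longrightarrow> d * x \<in> right_span D"
  unfolding right_span_def by (intro CollectI exI[of _ "{d}"] exI[of _ "\<lambda>_. x"]) auto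

lemma right_span_zero: "0 \<in> right_span D"
  unfolding right_span_def by (intro CollectI exI[of _ "{}"]) auto

lemma right_span_add:
  assumes "a \<in> right_span D" "b \<in> right_span D"
  shows "a + b \<in> right_span D"
proof -
  have ab: "finite {a, b}" "{a, b} \<subseteq> right_span D" using assms by auto
  obtain D' x where D: "finite D'" "D' \<subseteq> D" "\<forall>c\<in>{a, b}. c = (\<Sum>d\<in>D'. d * x c d)"
    using right_span_common[OF ab] .
  have "a + b = (\<Sum>d\<in>D'. d * (x a d + x b d))"
    unfolding distrib_left sum.distrib
    by (rule arg_cong2[of _ _ _ _ "(+)"]; rule D(3)[rule_format]) simp_all
  then show ?thesis unfolding right_span_def
    using D(1,2) by (intro CollectI exI[of _ D'] exI[of _ "\<lambda>d. x a d + x b d"]) simp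
qed

text \<open>The basis consists of elements whose
  leading words are the prefix-minimal leading words of the ideal.\<close>

theorem free_algebra_right_ideal_basis:
  fixes M :: "('x list \<Rightarrow>\<^sub>0 'k::field) set"
  assumes diff: "\<And>a b. a \<in> M \<Longrightarrow> b \<in> M \<Longrightarrow> a - b \<in> M"
    and mult: "\<And>a x. a \<in> M \<Longrightarrow> a * x \<in> M"
  obtains D where "D \<subseteq> M" "M \<subseteq> right_span D"
    "\<forall>D' x. finite D' \<longrightarrow> D' \<subseteq> D \<longrightarrow> (\<Sum>d\<in>D'. d * x d) = 0 \<longrightarrow> (\<forall>d\<in>D'. x d = 0)"
proof -
  obtain less :: "('x list \<times> 'x list) set" where "word_order less"
    using word_order_exists by blast
  interpret word_order less by fact
  define W where "W = {w. \<exists>m\<in>M. leading m w}"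
  define B where "B = {w\<in>W. \<forall>u t. w = u @ t \<longrightarrow> u \<in> W \<longrightarrow> t = []}"
  have "\<forall>w\<in>B. \<exists>m\<in>M. leading m w" by (auto simp: B_def W_def)
  then obtain b where b: "\<And>w. w \<in> B \<Longrightarrow> b w \<in> M \<and> leading (b w) w" by metis
  have prefix: "\<exists>u t. w = u @ t \<and> u \<in> B" if "w \<in> W" for w
    using that
  proof (induction "length w" arbitrary: w rule: less_induct)
    case less
    show ?case
    proof (cases "w \<in> B")
      case False
      then obtain u t where ut: "w = u @ t" "u \<in> W" "t \<noteq> []" using less.prems by (auto simp: B_def)
      then obtain u' t' where "u = u' @ t'" "u' \<in> B" using less.hyps[of u] by auto
      then show ?thesis using ut by (metis append.assoc)
    qed auto
  qed
  have leading_span: "m \<in> right_span (b ` B)" if "m \<in> M" "leading m w" for m w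
    using wf that
  proof (induction w arbitrary: m rule: wf_induct_rule)
    case (less w)
    then have "w \<in> W" by (auto simp: W_def)
    then obtain u t where ut: "w = u @ t" "u \<in> B" using prefix by blast
    \<comment> \<open>With this choice \<open>z\<close> has the same leading term as
      \<open>m\<close>, so \<open>m - z\<close> is \<open>0\<close> or has a smaller leading word
      and the induction applies.\<close>
    define c where "c = lookup m w / lookup (b u) u"
    define z where "z = b u * single t c"
    have bu: "b u \<in> M" "leading (b u) u" using b ut by auto
    have z: "z \<in> M" "z \<in> right_span (b ` B)"
      unfolding z_def using mult bu ut by (auto intro: right_span_base)
    have nz: "lookup m w \<noteq> 0" "lookup (b u) u \<noteq> 0"
      using less.prems bu by (auto simp: leading_def in_keys_iff)
    then have "c \<noteq> 0" by (simp add: c_def)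
    then have t: "leading (single t c) t" by (simp add: leading_def)
    have lz: "leading z w" using leading_mult[OF bu(2) t] by (simp add: z_def ut)
    have "lookup z w = lookup m w"
      using lookup_mult_leading[OF bu(2) t] nz by (simp add: z_def ut c_def)
    then have w: "w \<notin> keys (m - z)" by (simp add: in_keys_iff lookup_minus)
    have "m - z \<in> right_span (b ` B)"
    proof (cases "m - z = 0")
      case False
      then obtain v where v: "leading (m - z) v" using leading_exists by blast
      then have "v \<in> keys m \<or> v \<in> keys z"
        by (auto simp: leading_def in_keys_iff lookup_minus)
      moreover have "v \<noteq> w" using v w by (auto simp: leading_def)
      ultimately have "(v, w) \<in> less" using less.prems(2) lz unfolding leading_def by blast
      then show ?thesis using less.IH v diff less.prems(1) z(1) by blast
    qed (simp add: right_span_zero)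
    then have "(m - z) + z \<in> right_span (b ` B)" using z(2) by (rule right_span_add)
    then show ?case by simp
  qed
  show ?thesis
  proof (rule that[of "b ` B"]; (intro allI impI ballI)?)
    show "b ` B \<subseteq> M" using b by auto
    show "M \<subseteq> right_span (b ` B)"
    proof
      fix m assume "m \<in> M"
      then show "m \<in> right_span (b ` B)"
        using leading_span[of m] leading_exists[of m] right_span_zero by (cases "m = 0") auto
    qed
    fix D' x d
    assume D': "finite D'" "D' \<subseteq> b ` B" "(\<Sum>d\<in>D'. d * x d) = 0" "d \<in> D'"
    have "\<forall>d\<in>D'. \<exists>w\<in>B. d = b w" using D'(2) by blast
    then obtain l where l: "\<And>d. d \<in> D' \<Longrightarrow> l d \<in> B \<and> d = b (l d)" by metis
    show "x d = 0"
    proof (rule prefix_free_independent[OF D'(1) _ _ D'(3) D'(4), of l])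
      show "leading d (l d)" if "d \<in> D'" for d using l b that by metis
      show "c = d" if "c \<in> D'" "d \<in> D'" "l d = l c @ t" for c d t
      proof -
        have "l c \<in> B" "l d \<in> B" using l that(1,2) by blast+
        then have "l c \<in> W" "l d \<in> B" by (auto simp: B_def)
        then have "t = []" using that(3) unfolding B_def by blast
        then show ?thesis using l that by (metis append_Nil2)
      qed
    qed
  qed
qed

section \<open>Congruence modulo an ideal\<close>

text \<open>Equations in a quotient are handled as congruences between representatives, which stay
  in a ring with unit.\<close>

locale ring_ideal =
  fixes J :: "'r::ring_1 set"
  assumes zero_mem: "0 \<in> J" and diff_mem: "x \<in> J \<Longrightarrow> y \<in> J \<Longrightarrow> x - y \<in> J"
    and left_mult_mem: "x \<in> J \<Longrightarrow> z * x \<in> J" and right_mult_mem: "x \<in> J \<Longrightarrow> x * z \<in> J"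
begin

definition cong :: "'r \<Rightarrow> 'r \<Rightarrow> bool" (infix \<open>\<approx>\<close> 50) where
  "x \<approx> y \<longleftrightarrow> x - y \<in> J"

lemma uminus_mem: "x \<in> J \<Longrightarrow> - x \<in> J"
  using diff_mem[of 0 x] zero_mem by simp

lemma add_mem: "x \<in> J \<Longrightarrow> y \<in> J \<Longrightarrow> x + y \<in> J"
  using diff_mem[of x "- y"] uminus_mem by simp

lemma cong_refl [simp, intro]: "x \<approx> x"
  by (simp add: cong_def zero_mem)

lemma cong_sym: "x \<approx> y \<Longrightarrow> y \<approx> x"
  using uminus_mem[of "x - y"] by (simp add: cong_def)

lemma cong_trans [trans]: "x \<approx> y \<Longrightarrow> y \<approx> z \<Longrightarrow> x \<approx> z"
  using add_mem[of "x - y" "y - z"] by (simp add: cong_def)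

lemma cong_add: "x \<approx> x' \<Longrightarrow> y \<approx> y' \<Longrightarrow> x + y \<approx> x' + y'"
  using add_mem[of "x - x'" "y - y'"] by (simp add: cong_def algebra_simps)

lemma cong_diff: "x \<approx> x' \<Longrightarrow> y \<approx> y' \<Longrightarrow> x - y \<approx> x' - y'"
  using diff_mem[of "x - x'" "y - y'"] by (simp add: cong_def algebra_simps)

lemma cong_left: "x \<approx> y \<Longrightarrow> z * x \<approx> z * y"
  using left_mult_mem[of "x - y" z] by (simp add: cong_def algebra_simps)

lemma cong_right: "x \<approx> y \<Longrightarrow> x * z \<approx> y * z"
  using right_mult_mem[of "x - y" z] by (simp add: cong_def algebra_simps)

lemma cong_mult: "x \<approx> x' \<Longrightarrow> y \<approx> y' \<Longrightarrow> x * y \<approx> x' * y'"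
  by (rule cong_trans[OF cong_right cong_left])

lemma cong_sum: "(\<And>i. i \<in> I \<Longrightarrow> x i \<approx> y i) \<Longrightarrow> (\<Sum>i\<in>I. x i) \<approx> (\<Sum>i\<in>I. y i)"
  by (induction I rule: infinite_finite_induct) (auto intro: cong_add)

lemma cong_zero_iff: "x \<approx> 0 \<longleftrightarrow> x \<in> J"
  by (simp add: cong_def)

lemma cong_mem: "x \<approx> y \<Longrightarrow> y \<in> J \<Longrightarrow> x \<in> J"
  using cong_trans[of x y 0] by (simp add: cong_zero_iff)

lemma sum_mem: "(\<And>i. i \<in> I \<Longrightarrow> x i \<in> J) \<Longrightarrow> (\<Sum>i\<in>I. x i) \<in> J"
  by (induction I rule: infinite_finite_induct) (auto intro: add_mem zero_mem)

end

section \<open>Leavitt families and flatness\<close>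

text \<open>A Leavitt family of a finite graph with vertices \<open>V\<close>, edges \<open>F\<close>, source \<open>s\<close> and range \<open>t\<close>:
  idempotents \<open>P\<close>, edges \<open>A\<close> and ghost edges \<open>G\<close> modulo the ideal \<open>J\<close>.\<close>

locale leavitt_family = ring_ideal J for J :: "'r::ring_1 set" +
  fixes V :: "'a set" and F :: "'b set" and s t :: "'b \<Rightarrow> 'a"
    and \<iota> :: "'k::field \<Rightarrow> 'r" and P :: "'a \<Rightarrow> 'r" and A G :: "'b \<Rightarrow> 'r"
  assumes finite_V: "finite V" and finite_F: "finite F"
    and s_V: "e \<in> F \<Longrightarrow> s e \<in> V" and t_V: "e \<in> F \<Longrightarrow> t e \<in> V"
    and scalar_add: "\<iota> (c + d) = \<iota> c + \<iota> d" and scalar_mult: "\<iota> (c * d) = \<iota> c * \<iota> d"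
    and scalar_one: "\<iota> 1 = 1" and scalar_central: "x * \<iota> c = \<iota> c * x"
    and P_P: "a \<in> V \<Longrightarrow> b \<in> V \<Longrightarrow> P a * P b \<approx> (if a = b then P a else 0)"
    and P_A: "e \<in> F \<Longrightarrow> P (s e) * A e \<approx> A e" and A_P: "e \<in> F \<Longrightarrow> A e * P (t e) \<approx> A e"
    and P_G: "e \<in> F \<Longrightarrow> P (t e) * G e \<approx> G e" and G_P: "e \<in> F \<Longrightarrow> G e * P (s e) \<approx> G e"
    and G_A: "e \<in> F \<Longrightarrow> f \<in> F \<Longrightarrow> G e * A f \<approx> (if e = f then P (t e) else 0)"
    and P_sum: "a \<in> V \<Longrightarrow> {e\<in>F. s e = a} \<noteq> {} \<Longrightarrow> P a \<approx> (\<Sum>e | e \<in> F \<and> s e = a. A e * G e)"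
begin

section \<open>Paths and ghost paths of a Leavitt family\<close>

primrec is_path :: "'a \<Rightarrow> 'b list \<Rightarrow> 'a \<Rightarrow> bool" where
  "is_path a [] b \<longleftrightarrow> a = b \<and> a \<in> V"
| "is_path a (e # es) b \<longleftrightarrow> e \<in> F \<and> s e = a \<and> is_path (t e) es b"

text \<open>A nonempty path absorbs the factor \<open>P a\<close>; for the empty path this factor
  yields the idempotent of the vertex instead of \<open>1\<close>.\<close>

definition path_elt :: "'a \<Rightarrow> 'b list \<Rightarrow> 'r" where
  "path_elt a es = P a * prod_list (map A es)"

text \<open>The order is reversed, as the involution of the algebra reverses products.\<close>

primrec ghost_prod :: "'b list \<Rightarrow> 'r" where
  "ghost_prod [] = 1"
| "ghost_prod (e # es) = ghost_prod es * G e"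

definition path_star :: "'a \<Rightarrow> 'b list \<Rightarrow> 'r" where
  "path_star a es = ghost_prod es * P a"

definition sink :: "'a \<Rightarrow> bool" where
  "sink a \<longleftrightarrow> (\<forall>e\<in>F. s e \<noteq> a)"

lemma path_V: "is_path a es b \<Longrightarrow> a \<in> V" "is_path a es b \<Longrightarrow> b \<in> V"
  by (induction es arbitrary: a) (auto simp: s_V)

lemma path_elt_Cons:
  assumes "e \<in> F"
  shows "path_elt (s e) (e # es) \<approx> A e * path_elt (t e) es"
proof -
  have "path_elt (s e) (e # es) \<approx> A e * prod_list (map A es)"
    using cong_right[OF P_A[OF assms]] by (simp add: path_elt_def mult.assoc)
  also have "\<dots> \<approx> A e * P (t e) * prod_list (map A es)"
    by (rule cong_right[OF cong_sym[OF A_P[OF assms]]])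
  finally show ?thesis by (simp add: path_elt_def mult.assoc)
qed

lemma path_star_Cons:
  assumes "e \<in> F"
  shows "path_star (s e) (e # es) \<approx> path_star (t e) es * G e"
proof -
  have "path_star (s e) (e # es) \<approx> ghost_prod es * G e"
    using cong_left[OF G_P[OF assms]] by (simp add: path_star_def mult.assoc)
  also have "\<dots> \<approx> ghost_prod es * (P (t e) * G e)"
    by (rule cong_left[OF cong_sym[OF P_G[OF assms]]])
  finally show ?thesis by (simp add: path_star_def mult.assoc)
qed

lemma P_path_elt:
  assumes "a \<in> V" "b \<in> V"
  shows "P b * path_elt a es \<approx> (if b = a then path_elt a es else 0)"
  using cong_right[OF P_P[OF assms(2,1)], of "prod_list (map A es)"]
  by (cases "b = a") (simp_all add: path_elt_def mult.assoc)

lemma path_elt_P: "is_path a es b \<Longrightarrow> path_elt a es * P b \<approx> path_elt a es"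
proof (induction es arbitrary: a)
  case Nil
  then show ?case using P_P[of a a] by (auto simp: path_elt_def)
next
  case (Cons e es)
  then have e: "e \<in> F" "s e = a" "is_path (t e) es b" by auto
  have "path_elt a (e # es) * P b \<approx> A e * path_elt (t e) es * P b"
    using cong_right[OF path_elt_Cons[OF e(1)]] e(2) by blast
  also have "\<dots> \<approx> A e * path_elt (t e) es"
    using cong_left[OF Cons.IH[OF e(3)]] by (simp add: mult.assoc)
  also have "\<dots> \<approx> path_elt a (e # es)"
    using cong_sym[OF path_elt_Cons[OF e(1)]] e(2) by blast
  finally show ?case .
qed

lemma P_path_star: "is_path a es b \<Longrightarrow> P b * path_star a es \<approx> path_star a es"
proof (induction es arbitrary: a)
  case Nil
  then show ?case using P_P[of a a] by (auto simp: path_star_def)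
next
  case (Cons e es)
  then have e: "e \<in> F" "s e = a" "is_path (t e) es b" by auto
  have "P b * path_star a (e # es) \<approx> P b * (path_star (t e) es * G e)"
    using cong_left[OF path_star_Cons[OF e(1)]] e(2) by blast
  also have "\<dots> \<approx> path_star (t e) es * G e"
    using cong_right[OF Cons.IH[OF e(3)]] by (simp add: mult.assoc)
  also have "\<dots> \<approx> path_star a (e # es)"
    using cong_sym[OF path_star_Cons[OF e(1)]] e(2) by blast
  finally show ?case .
qed

text \<open>By (CK1) the ghost edges cancel against the initial edges of the path, one pair at a
  time, or give \<open>0\<close>. The length condition ensures that no ghost edge is left
  over.\<close>

lemma path_star_path_elt:
  assumes "is_path a es b" "is_path c fs d" "length es \<le> length fs"
  shows "path_star a es * path_elt c fs \<approx>
    (if c = a \<and> take (length es) fs = es then path_elt b (drop (length es) fs) else 0)"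
  using assms
proof (induction es arbitrary: a c fs)
  case Nil
  then have "a \<in> V" "c \<in> V" "a = b" using path_V by auto
  then show ?case using P_path_elt[of c a fs] by (auto simp: path_star_def)
next
  case (Cons e es)
  then obtain f fs' where fs: "fs = f # fs'" by (cases fs) auto
  have e: "e \<in> F" "s e = a" "is_path (t e) es b" using Cons.prems by auto
  have f: "f \<in> F" "s f = c" "is_path (t f) fs' d" using Cons.prems fs by auto
  have "path_star a (e # es) * path_elt c fs \<approx> path_star (t e) es * G e * (A f * path_elt (t f) fs')"
    using cong_mult[OF path_star_Cons[OF e(1)] path_elt_Cons[OF f(1)]] e f fs by simp
  also have "\<dots> = path_star (t e) es * (G e * A f * path_elt (t f) fs')"
    by (simp add: mult.assoc)
  also have "\<dots> \<approx> path_star (t e) es * ((if e = f then P (t e) else 0) * path_elt (t f) fs')"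
    by (intro cong_left cong_right G_A e f)
  also have "\<dots> \<approx> (if e = f then path_star (t e) es * path_elt (t f) fs' else 0)"
    using cong_left[OF P_path_elt[of "t e" "t e" fs'], of "path_star (t e) es"] t_V[OF e(1)] by auto
  also have "\<dots> \<approx> (if c = a \<and> take (length (e # es)) fs = e # es
      then path_elt b (drop (length (e # es)) fs) else 0)"
    using Cons.IH[OF e(3) f(3)] Cons.prems(3) e f fs by auto
  finally show ?case .
qed

subsection \<open>Elements that turn long paths into combinations of paths\<close>

inductive_set path_span :: "nat \<Rightarrow> 'a \<Rightarrow> 'r set" for n b where
  gen: "is_path a es b \<Longrightarrow> n \<le> length es \<or> sink b \<Longrightarrow> \<iota> c * path_elt a es \<in> path_span n b"
| ideal: "x \<in> J \<Longrightarrow> x \<in> path_span n b"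
| add: "x \<in> path_span n b \<Longrightarrow> y \<in> path_span n b \<Longrightarrow> x + y \<in> path_span n b"

lemma path_span_cong: "x \<in> path_span n b \<Longrightarrow> y \<approx> x \<Longrightarrow> y \<in> path_span n b"
  using path_span.add[OF _ path_span.ideal[of "y - x"], of x n b] by (simp add: cong_def)

lemma path_span_path:
  "is_path a es b \<Longrightarrow> n \<le> length es \<or> sink b \<Longrightarrow> path_elt a es \<in> path_span n b"
  using path_span.gen[of a es b n 1] by (simp add: scalar_one)

lemma path_span_scalar: "x \<in> path_span n b \<Longrightarrow> \<iota> c * x \<in> path_span n b"
proof (induction rule: path_span.induct)
  case (gen a es c')
  then show ?case using path_span.gen[of a es b n "c * c'"] by (simp add: scalar_mult mult.assoc)
qed (auto simp: distrib_left intro: path_span.intros left_mult_mem)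

text \<open>\<open>N\<close> bounds the number of edges that the ghost edges of \<open>x\<close> can
  consume. Quantifying over the remaining length \<open>n\<close> makes these bounds add up in
  products.\<close>

definition tame :: "nat \<Rightarrow> 'r \<Rightarrow> bool" where
  "tame N x \<longleftrightarrow> (\<forall>n a es b. is_path a es b \<longrightarrow> n + N \<le> length es \<or> sink b \<longrightarrow>
     x * path_elt a es \<in> path_span n b)"

lemma tameD:
  "tame N x \<Longrightarrow> is_path a es b \<Longrightarrow> n + N \<le> length es \<or> sink b \<Longrightarrow> x * path_elt a es \<in> path_span n b"
  unfolding tame_def by blast

lemma tame_mono: "tame N x \<Longrightarrow> N \<le> N' \<Longrightarrow> tame N' x"
  unfolding tame_def by (meson add_le_cancel_left le_trans)

lemma tame_cong: "tame N x \<Longrightarrow> y \<approx> x \<Longrightarrow> tame N y"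
  unfolding tame_def using path_span_cong cong_right by blast

lemma tame_zero: "tame N 0"
  unfolding tame_def by (auto intro: path_span.ideal zero_mem)

lemma tame_add: "tame N x \<Longrightarrow> tame N y \<Longrightarrow> tame N (x + y)"
  unfolding tame_def distrib_right by (blast intro: path_span.add)

lemma tame_scalar: "tame N x \<Longrightarrow> tame N (\<iota> c * x)"
  unfolding tame_def mult.assoc by (blast intro: path_span_scalar)

lemma tame_path_span: "y \<in> path_span (n + N) b \<Longrightarrow> tame N x \<Longrightarrow> x * y \<in> path_span n b"
proof (induction rule: path_span.induct)
  case (gen a es c)
  then have "\<iota> c * (x * path_elt a es) \<in> path_span n b" by (blast intro: path_span_scalar tameD)
  then show ?case using scalar_central[of x c] by (simp add: mult.assoc[symmetric])
qed (auto simp: distrib_left intro: path_span.add path_span.ideal left_mult_mem)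

lemma tame_mult:
  assumes "tame N x" "tame M y"
  shows "tame (N + M) (x * y)"
  unfolding tame_def
proof (intro allI impI)
  fix n a es b assume p: "is_path a es b" "n + (N + M) \<le> length es \<or> sink b"
  have "y * path_elt a es \<in> path_span (n + N) b"
    using p by (intro tameD[OF assms(2)]) (auto simp: add.assoc)
  from tame_path_span[OF this assms(1)]
  show "x * y * path_elt a es \<in> path_span n b" by (simp add: mult.assoc)
qed

lemma tame_P:
  assumes "a \<in> V"
  shows "tame 0 (P a)"
  unfolding tame_def
proof (intro allI impI)
  fix n b es c assume p: "is_path b es c" "n + 0 \<le> length es \<or> sink c"
  have "P a * path_elt b es \<approx> (if a = b then path_elt b es else 0)"
    using P_path_elt assms path_V(1)[OF p(1)] by blast
  moreover have "(if a = b then path_elt b es else 0) \<in> path_span n c"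
    using p by (auto intro: path_span_path path_span.ideal zero_mem)
  ultimately show "P a * path_elt b es \<in> path_span n c" by (rule path_span_cong[rotated])
qed

lemma mult_P_path_elt_zero:
  assumes "x * P a \<approx> x" "a \<in> V" "b \<in> V" "a \<noteq> b"
  shows "x * path_elt b es \<in> J"
proof -
  have "x * path_elt b es \<approx> x * P a * path_elt b es"
    by (rule cong_right[OF cong_sym[OF assms(1)]])
  also have "\<dots> \<approx> x * 0"
    using cong_left[OF P_path_elt[OF assms(3,2)]] assms(4) by (simp add: mult.assoc)
  finally show ?thesis by (simp add: cong_zero_iff)
qed

lemma tame_A:
  assumes "e \<in> F"
  shows "tame 0 (A e)"
  unfolding tame_def
proof (intro allI impI)
  fix n b es c assume p: "is_path b es c" "n + 0 \<le> length es \<or> sink c"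
  show "A e * path_elt b es \<in> path_span n c"
  proof (cases "b = t e")
    case True
    then have "path_elt (s e) (e # es) \<in> path_span n c"
      using p assms by (intro path_span_path) auto
    then show ?thesis using path_span_cong cong_sym[OF path_elt_Cons[OF assms]] True by blast
  next
    case False
    then show ?thesis
      using mult_P_path_elt_zero[OF A_P] assms t_V path_V(1)[OF p(1)] path_span.ideal by metis
  qed
qed

lemma tame_G:
  assumes "e \<in> F"
  shows "tame 1 (G e)"
  unfolding tame_def
proof (intro allI impI)
  fix n b es c assume p: "is_path b es c" "n + 1 \<le> length es \<or> sink c"
  show "G e * path_elt b es \<in> path_span n c"
  proof (cases "b = s e")
    case True
    \<comment> \<open>An empty path would start and end at \<open>s e\<close> and satisfy the length
      condition only as a sink, but \<open>e\<close> leaves this vertex.\<close>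
    then obtain f fs where es: "es = f # fs"
      using p assms by (cases es) (auto simp: sink_def)
    then have f: "f \<in> F" "s f = b" "is_path (t f) fs c" using p by auto
    have "G e * path_elt b es \<approx> G e * (A f * path_elt (t f) fs)"
      using cong_left[OF path_elt_Cons[OF f(1)]] f es by simp
    also have "\<dots> \<approx> (if e = f then P (t e) else 0) * path_elt (t f) fs"
      using cong_right[OF G_A[OF assms f(1)]] by (simp add: mult.assoc)
    also have "\<dots> \<approx> (if e = f then path_elt (t f) fs else 0)"
      using P_path_elt[of "t e" "t e" fs] t_V[OF assms] by auto
    finally have "G e * path_elt b es \<approx> (if e = f then path_elt (t f) fs else 0)" .
    moreover have "(if e = f then path_elt (t f) fs else 0) \<in> path_span n c"
      using p f es by (auto intro: path_span_path path_span.ideal zero_mem)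
    ultimately show ?thesis by (rule path_span_cong[rotated])
  next
    case False
    then show ?thesis
      using mult_P_path_elt_zero[OF G_P] assms s_V path_V(1)[OF p(1)] path_span.ideal by metis
  qed
qed

lemma tame_path_star:
  assumes "is_path a es b"
  shows "\<exists>N. tame N (path_star a es)"
proof -
  have "\<exists>N. tame N (ghost_prod es)" if "set es \<subseteq> F"
    using that
  proof (induction es)
    case Nil
    then show ?case by (intro exI[of _ 0]) (auto simp: tame_def intro: path_span_path)
  next
    case (Cons e es)
    then show ?case using tame_mult tame_G by fastforce
  qed
  moreover have "set es \<subseteq> F" using assms by (induction es arbitrary: a) auto
  ultimately show ?thesis unfolding path_star_def
    using tame_mult tame_P path_V(1)[OF assms] by blast
qed

text \<open>The identity of the algebra of the finite graph; it need not be congruent to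
  \<open>1\<close>.\<close>

definition unit :: 'r where "unit = (\<Sum>a\<in>V. P a)"

text \<open>(CK2) is applied repeatedly: a vertex that is not a sink is replaced by the sum over its
  outgoing edges, and the ranges of these edges are resolved in turn.\<close>

lemma vertex_resolution:
  assumes "a \<in> V"
  shows "\<exists>Q. finite Q \<and> (\<forall>es\<in>Q. \<exists>b. is_path a es b \<and> (n \<le> length es \<or> sink b)) \<and>
    (\<Sum>es\<in>Q. path_elt a es * path_star a es) \<approx> P a"
  using assms
proof (induction n arbitrary: a)
  case 0
  then show ?case using P_P[of a a]
    by (intro exI[of _ "{[]}"]) (auto simp: path_elt_def path_star_def)
next
  case (Suc n)
  show ?case
  proof (cases "sink a")
    case True
    then show ?thesis using P_P[of a a] Suc.prems
      by (intro exI[of _ "{[]}"]) (auto simp: path_elt_def path_star_def)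
  next
    case False
    define Fa where "Fa = {e\<in>F. s e = a}"
    have Fa: "finite Fa" "Fa \<noteq> {}" "\<And>e. e \<in> Fa \<Longrightarrow> e \<in> F \<and> s e = a \<and> t e \<in> V"
      using finite_F False t_V by (auto simp: Fa_def sink_def)
    obtain Q where Q: "\<And>b. b \<in> V \<Longrightarrow> finite (Q b)"
      "\<And>b es. b \<in> V \<Longrightarrow> es \<in> Q b \<Longrightarrow> \<exists>c. is_path b es c \<and> (n \<le> length es \<or> sink c)"
      "\<And>b. b \<in> V \<Longrightarrow> (\<Sum>es\<in>Q b. path_elt b es * path_star b es) \<approx> P b"
      using Suc.IH by metis
    \<comment> \<open>The union is disjoint because its members are told apart by their first
      edge.\<close>
    let ?Q = "\<Union>e\<in>Fa. (#) e ` Q (t e)"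
    have "(\<Sum>es\<in>?Q. path_elt a es * path_star a es) =
        (\<Sum>e\<in>Fa. \<Sum>es\<in>(#) e ` Q (t e). path_elt a es * path_star a es)"
      using Fa Q(1) by (intro sum.UNION_disjoint) auto
    also have "\<dots> = (\<Sum>e\<in>Fa. \<Sum>es\<in>Q (t e). path_elt a (e # es) * path_star a (e # es))"
      by (simp add: sum.reindex)
    also have "\<dots> \<approx> (\<Sum>e\<in>Fa. \<Sum>es\<in>Q (t e). A e * path_elt (t e) es * (path_star (t e) es * G e))"
      by (intro cong_sum cong_mult) (use Fa path_elt_Cons path_star_Cons in blast)+
    also have "\<dots> = (\<Sum>e\<in>Fa. A e * (\<Sum>es\<in>Q (t e). path_elt (t e) es * path_star (t e) es) * G e)"
      by (simp add: sum_distrib_left sum_distrib_right mult.assoc)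
    also have "\<dots> \<approx> (\<Sum>e\<in>Fa. A e * P (t e) * G e)"
      by (intro cong_sum cong_right cong_left Q) (use Fa in auto)
    also have "\<dots> \<approx> (\<Sum>e\<in>Fa. A e * G e)"
      by (intro cong_sum cong_right A_P) (use Fa in auto)
    also have "\<dots> \<approx> P a"
      using P_sum[OF Suc.prems] Fa(2) cong_sym by (simp add: Fa_def)
    finally have "(\<Sum>es\<in>?Q. path_elt a es * path_star a es) \<approx> P a" .
    moreover have "finite ?Q" using Fa Q(1) by auto
    moreover have "\<forall>es\<in>?Q. \<exists>b. is_path a es b \<and> (Suc n \<le> length es \<or> sink b)"
    proof
      fix es assume "es \<in> ?Q"
      then obtain e es' where e: "e \<in> Fa" "es' \<in> Q (t e)" "es = e # es'" by blast
      then show "\<exists>b. is_path a es b \<and> (Suc n \<le> length es \<or> sink b)"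
        using Fa(3)[OF e(1)] Q(2)[of "t e" es'] by auto
    qed
    ultimately show ?thesis by blast
  qed
qed

lemma unit_resolution:
  obtains Q b where "finite Q"
    "\<forall>p\<in>Q. is_path (fst p) (snd p) (b p) \<and> (n \<le> length (snd p) \<or> sink (b p))"
    "(\<Sum>p\<in>Q. path_elt (fst p) (snd p) * path_star (fst p) (snd p)) \<approx> unit"
proof -
  obtain Q where Q: "\<And>a. a \<in> V \<Longrightarrow> finite (Q a)"
    "\<And>a es. a \<in> V \<Longrightarrow> es \<in> Q a \<Longrightarrow> \<exists>b. is_path a es b \<and> (n \<le> length es \<or> sink b)"
    "\<And>a. a \<in> V \<Longrightarrow> (\<Sum>es\<in>Q a. path_elt a es * path_star a es) \<approx> P a"
    using vertex_resolution[where n = n] by metis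
  have "\<forall>p\<in>Sigma V Q. \<exists>b. is_path (fst p) (snd p) b \<and> (n \<le> length (snd p) \<or> sink b)"
    using Q(2) by auto
  then obtain b where b: "\<forall>p\<in>Sigma V Q. is_path (fst p) (snd p) (b p) \<and> (n \<le> length (snd p) \<or> sink (b p))"
    by metis
  show ?thesis
  proof (rule that[of "Sigma V Q" b])
    show "finite (Sigma V Q)" using finite_V Q(1) by auto
    show "\<forall>p\<in>Sigma V Q. is_path (fst p) (snd p) (b p) \<and> (n \<le> length (snd p) \<or> sink (b p))"
      by (rule b)
    have "(\<Sum>p\<in>Sigma V Q. path_elt (fst p) (snd p) * path_star (fst p) (snd p)) =
        (\<Sum>a\<in>V. \<Sum>es\<in>Q a. path_elt a es * path_star a es)"
      using finite_V Q(1) by (subst sum.Sigma) (auto simp: split_def)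
    also have "\<dots> \<approx> unit" unfolding unit_def by (intro cong_sum Q)
    finally show "(\<Sum>p\<in>Sigma V Q. path_elt (fst p) (snd p) * path_star (fst p) (snd p)) \<approx> unit" .
  qed
qed

subsection \<open>Lifting to the free algebra\<close>

lemma scalar_left_commute: "x * (\<iota> c * y) = \<iota> c * (x * y)"
  using scalar_central[of x c] by (simp add: mult.assoc[symmetric])

primrec letter :: "'a + 'b \<Rightarrow> 'r" where
  "letter (Inl a) = P a"
| "letter (Inr e) = A e"

definition monomial :: "('a + 'b) list \<Rightarrow> 'k \<Rightarrow> 'r" where
  "monomial w c = \<iota> c * prod_list (map letter w)"

definition ev :: "(('a + 'b) list \<Rightarrow>\<^sub>0 'k) \<Rightarrow> 'r" where
  "ev = linear_ext monomial"

lemma monomial_add: "monomial w (c + d) = monomial w c + monomial w d"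
  by (simp add: monomial_def scalar_add distrib_right)

lemma monomial_mult: "monomial (u @ w) (c * d) = monomial u c * monomial w d"
  using scalar_left_commute[of "prod_list (map letter u)" d "prod_list (map letter w)"]
  by (simp add: monomial_def scalar_mult mult.assoc)

lemma ev_zero: "ev 0 = 0"
  unfolding ev_def by (rule linear_ext_zero) (rule monomial_add)

lemma ev_single: "ev (single w c) = monomial w c"
  unfolding ev_def by (rule linear_ext_single) (rule monomial_add)

lemma ev_add: "ev (f + g) = ev f + ev g"
  unfolding ev_def by (rule linear_ext_add) (rule monomial_add)

lemma ev_sum: "ev (\<Sum>i\<in>I. f i) = (\<Sum>i\<in>I. ev (f i))"
  unfolding ev_def by (rule linear_ext_sum) (rule monomial_add)

lemma ev_mult: "ev (f * g) = ev f * ev g"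
  unfolding ev_def by (rule linear_ext_mult) (rule monomial_add, rule monomial_mult)

lemma ev_eq_sum: "ev f = (\<Sum>w\<in>keys f. monomial w (lookup f w))"
  by (simp add: ev_def linear_ext_def)

text \<open>The vertex letter keeps the empty paths at different vertices apart. Only left factors
  carry it: a rooted path followed by a plain word of edges is again a rooted path, so products of
  paths are products of words.\<close>

definition rooted :: "'a \<Rightarrow> 'b list \<Rightarrow> ('a + 'b) list" where
  "rooted a es = Inl a # map Inr es"

lemma rooted_inject [simp]: "rooted a es = rooted b fs \<longleftrightarrow> a = b \<and> es = fs"
  by (simp add: rooted_def inj_map_eq_map)

lemma prod_letter_Inr: "prod_list (map letter (map Inr es)) = prod_list (map A es)"
  by (induction es) auto

lemma monomial_rooted: "monomial (rooted a es) c = \<iota> c * path_elt a es"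
  using prod_letter_Inr[of es] by (simp add: monomial_def rooted_def path_elt_def)

lemma path_span_lift:
  "x \<in> path_span n b \<Longrightarrow> \<exists>f. keys f \<subseteq> {rooted a es | a es. is_path a es b} \<and> x \<approx> ev f"
proof (induction rule: path_span.induct)
  case (gen a es c)
  have "ev (single (rooted a es) c) = \<iota> c * path_elt a es"
    by (simp add: ev_single monomial_rooted)
  then show ?case using gen by (intro exI[of _ "single (rooted a es) c"]) auto
next
  case (ideal x)
  then show ?case by (intro exI[of _ 0]) (simp add: ev_zero cong_zero_iff)
next
  case (add x y)
  then obtain f g where fg: "keys f \<subseteq> {rooted a es | a es. is_path a es b}" "x \<approx> ev f"
    "keys g \<subseteq> {rooted a es | a es. is_path a es b}" "y \<approx> ev g" by blast
  then have "keys (f + g) \<subseteq> {rooted a es | a es. is_path a es b}" using keys_add[of f g] by blast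
  moreover have "x + y \<approx> ev (f + g)" using fg by (simp add: ev_add cong_add)
  ultimately show ?case by blast
qed

text \<open>A nonempty path absorbs the vertices at both ends; for the empty path the two ends
  agree.\<close>

lemma path_elt_eq_prod:
  assumes "is_path a es b"
  shows "path_elt a es \<approx> prod_list (map A es) * P b"
proof (cases es)
  case Nil
  then show ?thesis using assms by (simp add: path_elt_def)
next
  case (Cons e es')
  have "path_elt a es \<approx> path_elt a es * P b" by (rule cong_sym[OF path_elt_P[OF assms]])
  also have "\<dots> \<approx> prod_list (map A es) * P b"
    using cong_right[OF P_A[of e], of "prod_list (map A es') * P b"] assms Cons
    by (simp add: path_elt_def mult.assoc)
  finally show ?thesis .
qed

text \<open>The factor \<open>P b\<close> makes up for the empty word, which is sent to \<open>1\<close> instead of \<open>P c\<close>.\<close>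

lemma path_span_lift_tail:
  assumes "c \<in> V"
  shows "x \<in> path_span n b \<Longrightarrow>
    \<exists>f. keys f \<subseteq> {map Inr es | es. is_path c es b} \<and> P c * x \<approx> ev f * P b"
proof (induction rule: path_span.induct)
  case (gen a es k)
  have *: "P c * (\<iota> k * path_elt a es) \<approx> \<iota> k * (if c = a then path_elt a es else 0)"
    unfolding scalar_left_commute using assms gen(1) path_V by (intro cong_left P_path_elt) auto
  show ?case
  proof (cases "c = a")
    case True
    have "ev (single (map Inr es) k) * P b = \<iota> k * (prod_list (map A es) * P b)"
      by (simp only: ev_single monomial_def prod_letter_Inr mult.assoc)
    then have "P c * (\<iota> k * path_elt a es) \<approx> ev (single (map Inr es) k) * P b"
      using * cong_left[OF path_elt_eq_prod[OF gen(1)], of "\<iota> k"] True cong_trans by simp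
    then show ?thesis using gen True by (intro exI[of _ "single (map Inr es) k"]) auto
  next
    case False
    then show ?thesis using * by (intro exI[of _ 0]) (simp add: ev_zero)
  qed
next
  case (ideal x)
  then show ?case by (intro exI[of _ 0]) (simp add: ev_zero cong_zero_iff left_mult_mem)
next
  case (add x y)
  then obtain f g where fg: "keys f \<subseteq> {map Inr es | es. is_path c es b}" "P c * x \<approx> ev f * P b"
    "keys g \<subseteq> {map Inr es | es. is_path c es b}" "P c * y \<approx> ev g * P b" by blast
  then have "keys (f + g) \<subseteq> {map Inr es | es. is_path c es b}" using keys_add[of f g] by blast
  moreover have "P c * (x + y) \<approx> ev (f + g) * P b"
    using fg by (simp add: ev_add distrib_left distrib_right cong_add)
  ultimately show ?case by blast
qed

lemma is_path_append: "is_path a (es @ fs) c \<longleftrightarrow> (\<exists>b. is_path a es b \<and> is_path b fs c)"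
  by (induction es arbitrary: a) (auto dest: path_V(1))

lemma is_path_unique: "is_path a es b \<Longrightarrow> is_path a es c \<Longrightarrow> b = c"
  by (induction es arbitrary: a) auto

lemma ev_mult_P:
  assumes "keys f \<subseteq> {rooted a es | a es. is_path a es b}"
  shows "ev f * P b \<approx> ev f"
  unfolding ev_eq_sum sum_distrib_right
proof (rule cong_sum)
  fix w assume "w \<in> keys f"
  then obtain a es where "w = rooted a es" "is_path a es b" using assms by blast
  then show "monomial w (lookup f w) * P b \<approx> monomial w (lookup f w)"
    using cong_left[OF path_elt_P] by (simp add: monomial_rooted mult.assoc)
qed

lemma rooted_mult_tail:
  fixes f g :: "('a + 'b) list \<Rightarrow>\<^sub>0 'k"
  assumes "keys f \<subseteq> {rooted a es | a es. is_path a es b}" "keys g \<subseteq> {map Inr es | es. is_path b es c}"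
  shows "keys (f * g) \<subseteq> {rooted a es | a es. is_path a es c}"
proof
  fix w assume "w \<in> keys (f * g)"
  then obtain u v where "u \<in> keys f" "v \<in> keys g" "w = u @ v" by (rule keys_mult_words)
  then obtain a es fs where "is_path a es b" "is_path b fs c" "w = rooted a (es @ fs)"
    using assms by (fastforce simp: rooted_def)
  then show "w \<in> {rooted a es | a es. is_path a es c}" using is_path_append by blast
qed

end

text \<open>\<open>constant_term\<close> is the part of linear independence that a degree argument
  yields directly: in a relation among paths from one vertex, the empty path has coefficient
  \<open>0\<close>.\<close>

locale free_leavitt_family = leavitt_family J V F s t \<iota> P A G
  for J :: "'r::ring_1 set" and V :: "'a set" and F :: "'b set" and s t :: "'b \<Rightarrow> 'a"
    and \<iota> :: "'k::field \<Rightarrow> 'r" and P :: "'a \<Rightarrow> 'r" and A G :: "'b \<Rightarrow> 'r" +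
  assumes constant_term: "a \<in> V \<Longrightarrow> finite \<Gamma> \<Longrightarrow> (\<And>es. es \<in> \<Gamma> \<Longrightarrow> \<exists>b. is_path a es b) \<Longrightarrow> [] \<in> \<Gamma> \<Longrightarrow>
    (\<Sum>es\<in>\<Gamma>. \<iota> (c es) * path_elt a es) \<in> J \<Longrightarrow> c [] = 0"
begin

text \<open>Multiply by the ghost of a shortest path that occurs. Every other path is annihilated or
  stripped of this initial segment, and the shortest path itself becomes an empty path, whose
  coefficient is \<open>0\<close> by \<open>constant_term\<close>.\<close>

lemma paths_independent:
  assumes keys: "keys f \<subseteq> {rooted a es | a es. \<exists>b. is_path a es b}" and J: "ev f \<in> J"
  shows "f = 0"
proof (rule ccontr)
  assume "f \<noteq> 0"
  then have "\<exists>w. w \<in> keys f" using keys_eq_empty by blast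
  then obtain w where w: "w \<in> keys f" "\<And>u. u \<in> keys f \<Longrightarrow> length w \<le> length u"
    using ex_has_least_nat[of "\<lambda>w. w \<in> keys f" _ length] by blast
  then obtain a es b where p: "w = rooted a es" "is_path a es b" using keys by blast
  \<comment> \<open>\<open>h\<close> puts the stripped segment back, so \<open>\<Gamma>\<close>
    collects what remains of the words that survive.\<close>
  define h where "h \<gamma> = rooted a (es @ \<gamma>)" for \<gamma>
  define \<Gamma> where "\<Gamma> = h -` keys f"
  have inj: "inj h" by (auto simp: inj_def h_def)
  then have fin: "finite \<Gamma>" unfolding \<Gamma>_def by (intro finite_vimageI) auto
  have summand: "path_star a es * monomial u (lookup f u) \<approx>
      (if u \<in> h ` \<Gamma> then \<iota> (lookup f u) * path_elt b (the_inv h u) else 0)"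
    if u: "u \<in> keys f" for u
  proof -
    obtain c fs d where q: "u = rooted c fs" "is_path c fs d" using keys u by blast
    have len: "length es \<le> length fs" using w(2)[OF u] p q by (simp add: rooted_def)
    have "path_star a es * monomial u (lookup f u) = \<iota> (lookup f u) * (path_star a es * path_elt c fs)"
      by (simp add: q monomial_rooted scalar_left_commute)
    also have "\<dots> \<approx> \<iota> (lookup f u) *
        (if c = a \<and> take (length es) fs = es then path_elt b (drop (length es) fs) else 0)"
      by (intro cong_left path_star_path_elt[OF p(2) q(2) len])
    also have "\<dots> = (if u \<in> h ` \<Gamma> then \<iota> (lookup f u) * path_elt b (the_inv h u) else 0)"
    proof (cases "c = a \<and> take (length es) fs = es")
      case True
      then have "u = h (drop (length es) fs)" by (metis append_take_drop_id h_def q(1))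
      then show ?thesis using True u inj by (auto simp: \<Gamma>_def the_inv_f_f)
    next
      case False
      then have "u \<notin> h ` \<Gamma>" using q by (auto simp: h_def)
      then show ?thesis by (simp only: False if_False mult_zero_right)
    qed
    finally show ?thesis .
  qed
  have "path_star a es * ev f = (\<Sum>u\<in>keys f. path_star a es * monomial u (lookup f u))"
    by (simp add: ev_eq_sum sum_distrib_left)
  also have "\<dots> \<approx> (\<Sum>u\<in>keys f. if u \<in> h ` \<Gamma> then \<iota> (lookup f u) * path_elt b (the_inv h u) else 0)"
    by (rule cong_sum) (rule summand)
  also have "\<dots> = (\<Sum>u\<in>h ` \<Gamma>. \<iota> (lookup f u) * path_elt b (the_inv h u))"
    by (rule sum.mono_neutral_cong_right) (auto simp: \<Gamma>_def)
  also have "\<dots> = (\<Sum>\<gamma>\<in>\<Gamma>. \<iota> (lookup f (h \<gamma>)) * path_elt b \<gamma>)"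
    using inj by (subst sum.reindex) (auto simp: the_inv_f_f intro: inj_on_subset)
  finally have "(\<Sum>\<gamma>\<in>\<Gamma>. \<iota> (lookup f (h \<gamma>)) * path_elt b \<gamma>) \<in> J"
    using cong_mem[OF cong_sym] left_mult_mem[OF J] by blast
  moreover have "\<exists>d. is_path b \<gamma> d" if "\<gamma> \<in> \<Gamma>" for \<gamma>
  proof -
    have "h \<gamma> \<in> keys f" using that by (simp add: \<Gamma>_def)
    then obtain d where "is_path a (es @ \<gamma>) d"
      using keys by (auto simp: h_def)
    then show ?thesis using p(2) is_path_append is_path_unique by metis
  qed
  moreover have "[] \<in> \<Gamma>" using w(1) p(1) by (simp add: \<Gamma>_def h_def)
  ultimately have "lookup f (h []) = 0"
    using constant_term[OF path_V(2)[OF p(2)] fin, where c = "\<lambda>\<gamma>. lookup f (h \<gamma>)"] by blast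
  then show False using w(1) p(1) by (simp add: h_def in_keys_iff)
qed

text \<open>Multiplication by long paths turns \<open>a\<close> into a row over the path algebra. A basis of the right
  ideal generated by this row factorizes \<open>T\<close> through a free module.\<close>

theorem flatness:
  fixes a r :: "'i \<Rightarrow> 'r"
  assumes C_add: "\<And>x y. x \<in> C \<Longrightarrow> y \<in> C \<Longrightarrow> x + y \<in> C" and C_zero: "0 \<in> C"
    and C_mult: "\<And>x y. x \<in> C \<Longrightarrow> y \<in> C \<Longrightarrow> x * y \<in> C"
    and C_scalar: "\<And>c x. x \<in> C \<Longrightarrow> \<iota> c * x \<in> C"
    and C_gen: "\<And>v. P v \<in> C" "\<And>e. A e \<in> C" "\<And>e. G e \<in> C"
    and I: "finite I"
    and tame_a: "\<And>i. i \<in> I \<Longrightarrow> \<exists>N. tame N (a i)" and tame_r: "\<And>i. i \<in> I \<Longrightarrow> \<exists>N. tame N (r i)"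
    and a_unit: "\<And>i. i \<in> I \<Longrightarrow> a i * unit \<approx> a i"
    and unit_r: "\<And>i. i \<in> I \<Longrightarrow> unit * r i \<approx> r i"
    and r_unit: "\<And>i. i \<in> I \<Longrightarrow> r i * unit \<approx> r i"
    and relation: "(\<Sum>i\<in>I. a i * r i) \<in> J"
  obtains T where "\<And>j i. T j i \<in> C" "\<And>i. i \<in> I \<Longrightarrow> a i \<approx> (\<Sum>j\<in>I. a j * T j i)"
    "\<And>j. j \<in> I \<Longrightarrow> (\<Sum>i\<in>I. T j i * r i) \<in> J"
proof -
  have C_sum: "(\<Sum>i\<in>S. x i) \<in> C" if "\<And>i. i \<in> S \<Longrightarrow> x i \<in> C" for S and x :: "'j \<Rightarrow> 'r"
    using that by (induction S rule: infinite_finite_induct) (auto intro: C_add C_zero)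
  have C_ev: "x * ev f \<in> C" "ev f * x \<in> C" if "x \<in> C" for x f
  proof -
    have letter: "letter l \<in> C" for l using C_gen by (cases l) auto
    \<comment> \<open>\<open>C\<close> need not contain \<open>1\<close>, whereas \<open>w\<close>
      may be empty; the factor \<open>y\<close> from \<open>C\<close> takes care of this.\<close>
    have "y * prod_list (map letter w) \<in> C \<and> prod_list (map letter w) * y \<in> C" if "y \<in> C" for y w
      using that
    proof (induction w arbitrary: y)
      case (Cons l w)
      have "y * letter l * prod_list (map letter w) \<in> C" "prod_list (map letter w) * y \<in> C"
        using Cons letter C_mult by blast+
      then show ?case using letter C_mult by (simp add: mult.assoc)
    qed simp
    then show "x * ev f \<in> C" "ev f * x \<in> C"
      unfolding ev_eq_sum sum_distrib_left sum_distrib_right monomial_def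
      using that by (auto intro!: C_sum C_scalar simp: scalar_left_commute mult.assoc)
  qed
  have common: "\<exists>N. \<forall>x\<in>S. tame N (g x)"
    if "finite S" "\<And>x. x \<in> S \<Longrightarrow> \<exists>N. tame N (g x)" for S and g :: "'j \<Rightarrow> 'r"
    using that
  proof (induction S rule: finite_induct)
    case (insert x S)
    then obtain N N' where "\<forall>x\<in>S. tame N (g x)" "tame N' (g x)" by blast
    then have "\<forall>y\<in>insert x S. tame (max N N') (g y)"
      using tame_mono[of N _ "max N N'"] tame_mono[of N' _ "max N N'"] by simp
    then show ?case by (rule exI)
  qed simp
  obtain N where N: "\<And>i. i \<in> I \<Longrightarrow> tame N (a i)" using common[of I a] I tame_a by blast
  \<comment> \<open>The paths are long enough to absorb all ghost edges in the row
    \<open>a\<close>.\<close>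
  obtain Q b where Q: "finite Q"
    and Q_all: "\<forall>p\<in>Q. is_path (fst p) (snd p) (b p) \<and> (N \<le> length (snd p) \<or> sink (b p))"
    and Q_unit: "(\<Sum>p\<in>Q. path_elt (fst p) (snd p) * path_star (fst p) (snd p)) \<approx> unit"
    by (rule unit_resolution[of N])
  define E where "E p = path_elt (fst p) (snd p)" for p
  define S where "S p = path_star (fst p) (snd p)" for p
  have unit: "(\<Sum>p\<in>Q. E p * S p) \<approx> unit" using Q_unit by (simp add: E_def S_def)
  have Q_path: "is_path (fst p) (snd p) (b p)" "N \<le> length (snd p) \<or> sink (b p)" if "p \<in> Q" for p
    using Q_all that by blast+
  have "\<exists>f. keys f \<subseteq> {rooted c es | c es. is_path c es (b p)} \<and> a i * E p \<approx> ev f"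
    if "i \<in> I" "p \<in> Q" for i p
    unfolding E_def using N Q_path that by (intro path_span_lift[of _ 0] tameD[of N]) auto
  then have "\<forall>x\<in>I \<times> Q. \<exists>f. keys f \<subseteq> {rooted c es | c es. is_path c es (b (snd x))} \<and>
      a (fst x) * E (snd x) \<approx> ev f"
    by auto
  from bchoice[OF this] obtain Af where "\<forall>x\<in>I \<times> Q.
      keys (Af x) \<subseteq> {rooted c es | c es. is_path c es (b (snd x))} \<and>
      a (fst x) * E (snd x) \<approx> ev (Af x)" ..
  then have Af: "keys (Af (i, p)) \<subseteq> {rooted c es | c es. is_path c es (b p)}"
    "a i * E p \<approx> ev (Af (i, p))" if "i \<in> I" "p \<in> Q" for i p
    using that by auto
  define X where "X = I \<times> Q"
  have X: "finite X" using I Q by (simp add: X_def)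
  define M where "M = {\<Sum>x\<in>X. Af x * g x | g. True}"
  have M: "x \<in> M \<longleftrightarrow> (\<exists>g. x = (\<Sum>x\<in>X. Af x * g x))" for x by (auto simp: M_def)
  have M_diff: "x - y \<in> M" if xy: "x \<in> M" "y \<in> M" for x y
  proof -
    from xy obtain g h where "x = (\<Sum>x\<in>X. Af x * g x)" "y = (\<Sum>x\<in>X. Af x * h x)"
      unfolding M by blast
    then have "x - y = (\<Sum>x\<in>X. Af x * (g x - h x))"
      by (simp add: right_diff_distrib sum_subtractf)
    then show ?thesis unfolding M by (rule exI[of _ "\<lambda>z. g z - h z"])
  qed
  have M_mult: "x * y \<in> M" if x: "x \<in> M" for x y
  proof -
    from x obtain g where "x = (\<Sum>x\<in>X. Af x * g x)" unfolding M by blast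
    then have "x * y = (\<Sum>x\<in>X. Af x * (g x * y))"
      by (simp add: sum_distrib_right mult.assoc)
    then show ?thesis unfolding M by (rule exI[of _ "\<lambda>z. g z * y"])
  qed
  obtain D where D: "D \<subseteq> M" "M \<subseteq> right_span D"
    "\<forall>D' x. finite D' \<longrightarrow> D' \<subseteq> D \<longrightarrow> (\<Sum>d\<in>D'. d * x d) = 0 \<longrightarrow> (\<forall>d\<in>D'. x d = 0)"
    using free_algebra_right_ideal_basis[of M, OF M_diff M_mult] .
  have "Af x \<in> M" if x: "x \<in> X" for x
  proof -
    have "(\<Sum>y\<in>X. Af y * (if y = x then 1 else 0)) = (\<Sum>y\<in>X. if y = x then Af y else 0)"
      by (rule sum.cong) auto
    then show ?thesis unfolding M using x X by (intro exI[of _ "\<lambda>y. if y = x then 1 else 0"]) simp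
  qed
  then have Af_span: "Af ` X \<subseteq> right_span D" using D(2) by blast
  obtain D' \<sigma> where D': "finite D'" "D' \<subseteq> D"
    and \<sigma>: "\<forall>f\<in>Af ` X. f = (\<Sum>d\<in>D'. d * \<sigma> f d)"
    using right_span_common[OF finite_imageI[OF X] Af_span] .
  have "\<forall>d\<in>D'. \<exists>g. d = (\<Sum>x\<in>X. Af x * g x)" using D(1) D'(2) M by blast
  then obtain g where g: "\<And>d. d \<in> D' \<Longrightarrow> d = (\<Sum>x\<in>X. Af x * g d x)" by metis
  \<comment> \<open>In matrix form, up to evaluation: \<open>Af\<close> is the row
    \<open>a E\<close>, and \<open>Af = D' \<sigma>\<close>, \<open>D' = Af g\<close>. Hence
    \<open>a U = D'\<close> for \<open>U = E g\<close>, and \<open>D' W = a E S = a\<close> for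
    \<open>W = \<sigma> S\<close>, which gives \<open>a T = a\<close>.\<close>
  define U where "U j d = (\<Sum>p\<in>Q. E p * ev (g d (j, p)))" for j d
  define W where "W d i = (\<Sum>p\<in>Q. ev (\<sigma> (Af (i, p)) d) * S p)" for d i
  define T where "T j i = (\<Sum>d\<in>D'. U j d * W d i)" for j i

  have E_C: "E p \<in> C" for p
  proof -
    have "y * prod_list (map A es) \<in> C" if "y \<in> C" for y es
      using that
    proof (induction es arbitrary: y)
      case (Cons e es)
      then have "y * A e * prod_list (map A es) \<in> C" using C_gen C_mult by blast
      then show ?case by (simp add: mult.assoc)
    qed simp
    then show ?thesis using C_gen by (simp add: E_def path_elt_def)
  qed
  have S_C: "S p \<in> C" for p
  proof -
    have "ghost_prod es * y \<in> C" if "y \<in> C" for y es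
      using that
    proof (induction es arbitrary: y)
      case (Cons e es)
      then have "ghost_prod es * (G e * y) \<in> C" using C_gen C_mult by blast
      then show ?case by (simp add: mult.assoc)
    qed simp
    then show ?thesis using C_gen by (simp add: S_def path_star_def)
  qed
  have T_C: "T j i \<in> C" for j i
    unfolding T_def U_def W_def by (intro C_sum C_mult C_ev E_C S_C)

  have d_eq: "ev d \<approx> (\<Sum>j\<in>I. a j * U j d)" if d: "d \<in> D'" for d
  proof -
    have "ev d = (\<Sum>j\<in>I. \<Sum>p\<in>Q. ev (Af (j, p)) * ev (g d (j, p)))"
      by (subst g[OF d]) (simp add: ev_sum ev_mult X_def sum.cartesian_product)
    also have "\<dots> \<approx> (\<Sum>j\<in>I. \<Sum>p\<in>Q. a j * E p * ev (g d (j, p)))"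
      by (intro cong_sum cong_right cong_sym[OF Af(2)])
    finally show ?thesis by (simp add: U_def sum_distrib_left mult.assoc)
  qed
  have a_eq: "a i \<approx> (\<Sum>d\<in>D'. ev d * W d i)" if i: "i \<in> I" for i
  proof -
    have "a i \<approx> a i * unit" by (rule cong_sym[OF a_unit[OF i]])
    also have "\<dots> \<approx> a i * (\<Sum>p\<in>Q. E p * S p)" by (rule cong_left[OF cong_sym[OF unit]])
    also have "\<dots> = (\<Sum>p\<in>Q. a i * E p * S p)" by (simp add: sum_distrib_left mult.assoc)
    also have "\<dots> \<approx> (\<Sum>p\<in>Q. ev (Af (i, p)) * S p)"
      by (intro cong_sum cong_right Af(2) i)
    also have "\<dots> = (\<Sum>p\<in>Q. ev (\<Sum>d\<in>D'. d * \<sigma> (Af (i, p)) d) * S p)"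
      using i \<sigma> by (intro sum.cong) (auto simp: X_def)
    also have "\<dots> = (\<Sum>p\<in>Q. \<Sum>d\<in>D'. ev d * (ev (\<sigma> (Af (i, p)) d) * S p))"
      by (simp add: ev_sum ev_mult sum_distrib_right mult.assoc)
    also have "\<dots> = (\<Sum>d\<in>D'. ev d * W d i)"
      unfolding W_def sum_distrib_left by (rule sum.swap)
    finally show ?thesis .
  qed
  have T_a: "a i \<approx> (\<Sum>j\<in>I. a j * T j i)" if i: "i \<in> I" for i
  proof -
    note a_eq[OF i]
    also have "(\<Sum>d\<in>D'. ev d * W d i) \<approx> (\<Sum>d\<in>D'. (\<Sum>j\<in>I. a j * U j d) * W d i)"
      by (intro cong_sum cong_right d_eq)
    also have "\<dots> = (\<Sum>d\<in>D'. \<Sum>j\<in>I. a j * (U j d * W d i))"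
      by (simp add: sum_distrib_right mult.assoc)
    also have "\<dots> = (\<Sum>j\<in>I. a j * T j i)"
      unfolding T_def sum_distrib_left by (rule sum.swap)
    finally show ?thesis .
  qed

  \<comment> \<open>For \<open>T r = 0\<close> it suffices that \<open>W r = 0\<close>. The products
    \<open>S p * r i\<close> contain ghost edges again. A second resolution of the unit absorbs
    them; its length depends on \<open>Q\<close>.\<close>
  have "\<exists>N. tame N (S p * r i)" if "p \<in> Q" "i \<in> I" for p i
    unfolding S_def using tame_path_star[OF Q_path(1)[OF that(1)]] tame_r[OF that(2)]
    by (blast intro: tame_mult)
  then have "\<exists>N. \<forall>x\<in>X. tame N (S (snd x) * r (fst x))"
    using X by (intro common) (auto simp: X_def)
  then obtain N2 where N2: "\<And>i p. i \<in> I \<Longrightarrow> p \<in> Q \<Longrightarrow> tame N2 (S p * r i)"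
    by (auto simp: X_def)
  obtain Q2 b2 where "finite Q2"
    and Q2_all: "\<forall>q\<in>Q2. is_path (fst q) (snd q) (b2 q) \<and> (N2 \<le> length (snd q) \<or> sink (b2 q))"
    and Q2_unit: "(\<Sum>q\<in>Q2. path_elt (fst q) (snd q) * path_star (fst q) (snd q)) \<approx> unit"
    by (rule unit_resolution[of N2])
  have unit2: "(\<Sum>q\<in>Q2. E q * S q) \<approx> unit" using Q2_unit by (simp add: E_def S_def)
  have W_r_E: "(\<Sum>i\<in>I. W d i * r i) * E q \<in> J" if d: "d \<in> D'" and q: "q \<in> Q2" for d q
  proof -
    have q_path: "is_path (fst q) (snd q) (b2 q)" "N2 \<le> length (snd q) \<or> sink (b2 q)"
      using Q2_all q by blast+
    have "\<exists>f. keys f \<subseteq> {map Inr es | es. is_path (b p) es (b2 q)} \<and>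
        S p * r i * E q \<approx> ev f * P (b2 q)" if ip: "i \<in> I" "p \<in> Q" for i p
    proof -
      have "S p * r i * E q \<in> path_span 0 (b2 q)"
        unfolding E_def using N2 q_path that by (intro tameD[of N2]) auto
      then obtain f where f: "keys f \<subseteq> {map Inr es | es. is_path (b p) es (b2 q)}"
        "P (b p) * (S p * r i * E q) \<approx> ev f * P (b2 q)"
        using path_span_lift_tail path_V(2)[OF Q_path(1)[OF ip(2)]] by blast
      \<comment> \<open>\<open>S p\<close> begins at the end \<open>b p\<close> of its path, so only
        paths from \<open>b p\<close> remain, and these compose with the paths in
        \<open>Af (i, p)\<close>.\<close>
      have "P (b p) * S p * (r i * E q) \<approx> S p * (r i * E q)"
        unfolding S_def by (intro cong_right P_path_star Q_path that)
      then have "S p * r i * E q \<approx> P (b p) * (S p * r i * E q)"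
        unfolding mult.assoc by (rule cong_sym)
      then show ?thesis using f cong_trans by blast
    qed
    then have "\<forall>x\<in>I \<times> Q. \<exists>f. keys f \<subseteq> {map Inr es | es. is_path (b (snd x)) es (b2 q)} \<and>
        S (snd x) * r (fst x) * E q \<approx> ev f * P (b2 q)"
      by auto
    from bchoice[OF this] obtain Y where "\<forall>x\<in>I \<times> Q.
        keys (Y x) \<subseteq> {map Inr es | es. is_path (b (snd x)) es (b2 q)} \<and>
        S (snd x) * r (fst x) * E q \<approx> ev (Y x) * P (b2 q)" ..
    then have Y: "keys (Y (i, p)) \<subseteq> {map Inr es | es. is_path (b p) es (b2 q)}"
      "S p * r i * E q \<approx> ev (Y (i, p)) * P (b2 q)" if "i \<in> I" "p \<in> Q" for i p
      using that by auto
    \<comment> \<open>\<open>f\<close> evaluates to the given relation times \<open>E q\<close>,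
      hence into \<open>J\<close>. Since it is supported on paths, it is \<open>0\<close> already in
      the free algebra.\<close>
    define f where "f = (\<Sum>x\<in>X. Af x * Y x)"
    have "keys (Af x * Y x) \<subseteq> {rooted c es | c es. is_path c es (b2 q)}" if "x \<in> X" for x
    proof -
      have x: "x = (fst x, snd x)" "fst x \<in> I" "snd x \<in> Q" using that by (auto simp: X_def)
      show ?thesis using rooted_mult_tail[OF Af(1)[OF x(2,3)] Y(1)[OF x(2,3)]] by simp
    qed
    then have keys_f: "keys f \<subseteq> {rooted c es | c es. is_path c es (b2 q)}"
      unfolding f_def using keys_sum[of "\<lambda>x. Af x * Y x" X] by blast
    have "ev f \<approx> ev f * P (b2 q)" by (rule cong_sym[OF ev_mult_P[OF keys_f]])
    also have "\<dots> = (\<Sum>i\<in>I. \<Sum>p\<in>Q. ev (Af (i, p)) * (ev (Y (i, p)) * P (b2 q)))"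
      by (simp add: f_def ev_sum ev_mult X_def sum.cartesian_product sum_distrib_right mult.assoc)
    also have "\<dots> \<approx> (\<Sum>i\<in>I. \<Sum>p\<in>Q. a i * E p * (S p * r i * E q))"
      by (intro cong_sum cong_mult cong_sym[OF Af(2)] cong_sym[OF Y(2)])
    also have "\<dots> = (\<Sum>i\<in>I. a i * (\<Sum>p\<in>Q. E p * S p) * (r i * E q))"
      by (simp add: sum_distrib_left sum_distrib_right mult.assoc)
    also have "\<dots> \<approx> (\<Sum>i\<in>I. a i * unit * (r i * E q))"
      by (intro cong_sum cong_right cong_left unit)
    also have "\<dots> \<approx> (\<Sum>i\<in>I. a i * (r i * E q))"
      by (intro cong_sum cong_right a_unit)
    also have "\<dots> = (\<Sum>i\<in>I. a i * r i) * E q"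
      by (simp add: sum_distrib_right mult.assoc)
    finally have "ev f \<in> J" using right_mult_mem[OF relation] cong_mem by blast
    moreover have "keys f \<subseteq> {rooted c es | c es. \<exists>b. is_path c es b}" using keys_f by blast
    ultimately have "f = 0" by (intro paths_independent)
    \<comment> \<open>In terms of the basis, \<open>f = 0\<close> is a relation between basis
      elements, so each coefficient vanishes.\<close>
    have "(\<Sum>d\<in>D'. d * (\<Sum>x\<in>X. \<sigma> (Af x) d * Y x)) = (\<Sum>x\<in>X. (\<Sum>d\<in>D'. d * \<sigma> (Af x) d) * Y x)"
      unfolding sum_distrib_left sum_distrib_right mult.assoc by (rule sum.swap)
    also have "\<dots> = f"
      unfolding f_def
    proof (rule sum.cong[OF refl])
      fix x assume "x \<in> X"
      then have "Af x = (\<Sum>d\<in>D'. d * \<sigma> (Af x) d)" using \<sigma> by blast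
      then show "(\<Sum>d\<in>D'. d * \<sigma> (Af x) d) * Y x = Af x * Y x" by (rule arg_cong[OF sym])
    qed
    finally have "(\<Sum>x\<in>X. \<sigma> (Af x) d * Y x) = 0"
      using D(3)[rule_format, OF D' _ d, of "\<lambda>d. \<Sum>x\<in>X. \<sigma> (Af x) d * Y x"] \<open>f = 0\<close> by simp
    then have zero: "(\<Sum>i\<in>I. \<Sum>p\<in>Q. ev (\<sigma> (Af (i, p)) d) * ev (Y (i, p))) = 0"
      using ev_zero ev_sum[of "\<lambda>x. \<sigma> (Af x) d * Y x" X]
      by (simp add: ev_mult X_def sum.cartesian_product split_def)
    have "(\<Sum>i\<in>I. W d i * r i) * E q = (\<Sum>i\<in>I. \<Sum>p\<in>Q. ev (\<sigma> (Af (i, p)) d) * (S p * r i * E q))"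
      by (simp add: W_def sum_distrib_right mult.assoc)
    also have "\<dots> \<approx> (\<Sum>i\<in>I. \<Sum>p\<in>Q. ev (\<sigma> (Af (i, p)) d) * (ev (Y (i, p)) * P (b2 q)))"
      by (intro cong_sum cong_left Y(2))
    also have "\<dots> = (\<Sum>i\<in>I. \<Sum>p\<in>Q. ev (\<sigma> (Af (i, p)) d) * ev (Y (i, p))) * P (b2 q)"
      by (simp add: sum_distrib_right mult.assoc)
    also have "\<dots> = 0" using zero by simp
    finally show ?thesis by (simp add: cong_zero_iff)
  qed
  have W_r: "(\<Sum>i\<in>I. W d i * r i) \<in> J" if d: "d \<in> D'" for d
  proof -
    \<comment> \<open>The unit is inserted on the right and resolved into the paths
      \<open>E q\<close>, each of which has just been shown to give \<open>0\<close>.\<close>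
    have "(\<Sum>i\<in>I. W d i * r i) \<approx> (\<Sum>i\<in>I. W d i * (r i * unit))"
      by (intro cong_sum cong_left cong_sym[OF r_unit])
    also have "\<dots> = (\<Sum>i\<in>I. W d i * r i) * unit" by (simp add: sum_distrib_right mult.assoc)
    also have "\<dots> \<approx> (\<Sum>i\<in>I. W d i * r i) * (\<Sum>q\<in>Q2. E q * S q)"
      by (rule cong_left[OF cong_sym[OF unit2]])
    also have "\<dots> = (\<Sum>q\<in>Q2. (\<Sum>i\<in>I. W d i * r i) * E q * S q)"
      by (simp add: sum_distrib_left mult.assoc)
    finally show ?thesis
      by (rule cong_mem) (intro sum_mem right_mult_mem W_r_E d)
  qed
  have "(\<Sum>i\<in>I. T j i * r i) \<in> J" for j
  proof -
    have "(\<Sum>i\<in>I. T j i * r i) = (\<Sum>i\<in>I. \<Sum>d\<in>D'. U j d * (W d i * r i))"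
      by (simp add: T_def sum_distrib_right mult.assoc)
    also have "\<dots> = (\<Sum>d\<in>D'. U j d * (\<Sum>i\<in>I. W d i * r i))"
      unfolding sum_distrib_left by (rule sum.swap)
    finally show ?thesis using W_r by (auto intro: sum_mem left_mult_mem)
  qed
  then show thesis using that T_C T_a by blast
qed

end

section \<open>The ideal of relations of a Leavitt path algebra\<close>

lemma free_mult_eq: "free_mult p q = p * q"
  by (simp add: free_mult_def mult_eq_sum_single)

abbreviation scalar :: "'k::field \<Rightarrow> ('g list \<Rightarrow>\<^sub>0 'k)" where
  "scalar c \<equiv> single [] c"

lemma word_mult: "single u c * single w d = single (u @ w) (c * d :: 'k::ring_1)"
  by (simp add: mult_single plus_list_def)

lemma scalar_one: "scalar 1 = 1"
  unfolding zero_list_def[symmetric] by (rule single_one)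

lemma scalar_mult_eq: "scalar c * p = (\<Sum>w\<in>keys p. single w (c * lookup p w))"
  using poly_mapping_sum_single[of p]
  by (metis (mono_tags, lifting) append_Nil sum.cong sum_distrib_left word_mult)

lemma scalar_central: "p * scalar c = scalar c * p"
proof -
  have "p * scalar c = (\<Sum>w\<in>keys p. single w (lookup p w)) * scalar c"
    by (simp add: poly_mapping_sum_single[symmetric])
  then show ?thesis by (simp add: sum_distrib_right word_mult scalar_mult_eq mult.commute)
qed

lemma lookup_scalar_mult: "lookup (scalar c * p) w = c * lookup p w"
  by (simp add: scalar_mult_eq lookup_sum lookup_single when_def in_keys_iff)

lemma map_eq_scalar_mult: "Poly_Mapping.map ((*) c) p = scalar c * p"
  by (rule poly_mapping_eqI) (simp add: lookup_scalar_mult map.rep_eq when_def)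

definition words_over :: "'g set \<Rightarrow> ('g list \<Rightarrow>\<^sub>0 'k::field) set" where
  "words_over X = {p. \<forall>w\<in>keys p. w \<noteq> [] \<and> set w \<subseteq> X}"

lemma free_algebra_simps [simp]:
  "carrier (free_algebra X) = words_over X"
  "mult (free_algebra X) = (*)"
  "add (free_algebra X) = (+)"
  "zero (free_algebra X) = 0"
  "smult (free_algebra X) c p = scalar c * p"
  by (simp_all add: free_algebra_def words_over_def free_mult_eq map_eq_scalar_mult fun_eq_iff)

lemma words_over_zero: "0 \<in> words_over X"
  by (simp add: words_over_def)

lemma words_over_single: "w \<noteq> [] \<Longrightarrow> set w \<subseteq> X \<Longrightarrow> single w c \<in> words_over X"
  by (simp add: words_over_def)

lemma words_over_add: "p \<in> words_over X \<Longrightarrow> q \<in> words_over X \<Longrightarrow> p + q \<in> words_over X"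
  using keys_add[of p q] unfolding words_over_def by blast

lemma words_over_uminus: "p \<in> words_over X \<Longrightarrow> - p \<in> words_over X"
  unfolding words_over_def by (simp add: in_keys_iff)

lemma words_over_diff: "p \<in> words_over X \<Longrightarrow> q \<in> words_over X \<Longrightarrow> p - q \<in> words_over X"
  using words_over_add[of p X "- q"] words_over_uminus[of q X] by simp

lemma words_over_mult: "p \<in> words_over X \<Longrightarrow> q \<in> words_over X \<Longrightarrow> p * q \<in> words_over X"
  unfolding words_over_def by (fastforce elim!: keys_mult_words)

lemma words_over_scalar: "p \<in> words_over X \<Longrightarrow> scalar c * p \<in> words_over X"
  unfolding words_over_def by (simp add: in_keys_iff lookup_scalar_mult)

lemma words_over_sum: "(\<And>i. i \<in> I \<Longrightarrow> f i \<in> words_over X) \<Longrightarrow> (\<Sum>i\<in>I. f i) \<in> words_over X"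
  by (induction I rule: infinite_finite_induct) (auto intro: words_over_zero words_over_add)

lemma inv_free_algebra:
  assumes "p \<in> words_over X"
  shows "inv\<^bsub>add_monoid (free_algebra X)\<^esub> p = - p"
  unfolding m_inv_def
  using assms words_over_uminus by (intro the_equality) (auto simp: eq_neg_iff_add_eq_0 add.commute)

text \<open>Additive inverses are covered by the scalar \<open>- 1\<close>.\<close>

lemma algebra_ideal_free_algebra:
  "algebra_ideal I (free_algebra X) \<longleftrightarrow> I \<subseteq> words_over X \<and> 0 \<in> I \<and> (\<forall>p\<in>I. \<forall>q\<in>I. p + q \<in> I) \<and>
    (\<forall>p\<in>I. \<forall>x\<in>words_over X. x * p \<in> I \<and> p * x \<in> I) \<and> (\<forall>c. \<forall>p\<in>I. scalar c * p \<in> I)"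
    (is "?L \<longleftrightarrow> ?R")
proof
  assume ?L
  then show ?R
    by (auto simp: algebra_ideal_def two_sided_ideal_def additive_subgroup_def subgroup_def)
next
  assume R: ?R
  have "scalar (- 1) * p = - p" for p :: "'a list \<Rightarrow>\<^sub>0 'b"
    by (rule poly_mapping_eqI) (simp add: lookup_scalar_mult)
  then have "- p \<in> I" if "p \<in> I" for p using R that by metis
  then have "inv\<^bsub>add_monoid (free_algebra X)\<^esub> p \<in> I" if "p \<in> I" for p
    using R that inv_free_algebra[of p X] by auto
  then show ?L
    using R by (auto simp: algebra_ideal_def two_sided_ideal_def additive_subgroup_def subgroup_def)
qed

definition lpa_ideal :: "('v, 'e) pre_digraph \<Rightarrow> (('v, 'e) lpa_gen list \<Rightarrow>\<^sub>0 'k::field) set" where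
  "lpa_ideal E = algebra_ideal_generated (free_algebra (lpa_gens E)) (lpa_relators E)"

abbreviation lpa_words :: "('v, 'e) pre_digraph \<Rightarrow> (('v, 'e) lpa_gen list \<Rightarrow>\<^sub>0 'k::field) set" where
  "lpa_words E \<equiv> words_over (lpa_gens E)"

abbreviation vx :: "'v \<Rightarrow> ('v, 'e) lpa_gen list \<Rightarrow>\<^sub>0 'k::field" where "vx v \<equiv> word [Vertex v]"
abbreviation ed :: "'e \<Rightarrow> ('v, 'e) lpa_gen list \<Rightarrow>\<^sub>0 'k::field" where "ed e \<equiv> word [Edge e]"
abbreviation gh :: "'e \<Rightarrow> ('v, 'e) lpa_gen list \<Rightarrow>\<^sub>0 'k::field" where "gh e \<equiv> word [Ghost e]"

context wf_digraph
begin

lemma gen_words: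
  "v \<in> verts G \<Longrightarrow> vx v \<in> lpa_words G" "e \<in> arcs G \<Longrightarrow> ed e \<in> lpa_words G"
  "e \<in> arcs G \<Longrightarrow> gh e \<in> lpa_words G"
  by (auto simp: words_over_def lpa_gens_def)

lemma relators_words: "lpa_relators G \<subseteq> lpa_words G"
proof
  fix p :: "('a, 'b) lpa_gen list \<Rightarrow>\<^sub>0 'k::field" assume "p \<in> lpa_relators G"
  then show "p \<in> lpa_words G"
    unfolding lpa_relators_def
    by (auto intro!: words_over_diff words_over_sum words_over_zero words_over_single
        simp: regular_vertex_def lpa_gens_def)
qed

lemma algebra_ideal_lpa_ideal:
  "algebra_ideal (lpa_ideal G :: (_ \<Rightarrow>\<^sub>0 'k::field) set) (free_algebra (lpa_gens G))"
proof -
  \<comment> \<open>The whole free algebra is one of the intersected ideals; this keeps the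
    intersection inside it.\<close>
  have "algebra_ideal (lpa_words G :: (_ \<Rightarrow>\<^sub>0 'k) set) (free_algebra (lpa_gens G))"
    unfolding algebra_ideal_free_algebra
    by (auto intro: words_over_zero words_over_add words_over_mult words_over_scalar)
  then have words: "lpa_words G \<in> {I. algebra_ideal I (free_algebra (lpa_gens G)) \<and>
      (lpa_relators G :: (_ \<Rightarrow>\<^sub>0 'k) set) \<subseteq> I}"
    using relators_words by blast
  show ?thesis
    unfolding lpa_ideal_def algebra_ideal_generated_def algebra_ideal_free_algebra
  proof (intro conjI)
    show "\<Inter> {I. (I \<subseteq> lpa_words G \<and> 0 \<in> I \<and> (\<forall>p\<in>I. \<forall>q\<in>I. p + q \<in> I) \<and>
        (\<forall>p\<in>I. \<forall>x\<in>lpa_words G. x * p \<in> I \<and> p * x \<in> I) \<and> (\<forall>c. \<forall>p\<in>I. scalar c * p \<in> I)) \<and>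
        lpa_relators G \<subseteq> I} \<subseteq> (lpa_words G :: (_ \<Rightarrow>\<^sub>0 'k) set)"
      using words unfolding algebra_ideal_free_algebra by (rule Inter_lower)
  qed simp_all
qed

lemma relators_lpa_ideal: "lpa_relators G \<subseteq> lpa_ideal G"
  unfolding lpa_ideal_def algebra_ideal_generated_def by blast

lemma lpa_ideal_subset:
  "algebra_ideal I (free_algebra (lpa_gens G)) \<Longrightarrow> lpa_relators G \<subseteq> I \<Longrightarrow> lpa_ideal G \<subseteq> I"
  unfolding lpa_ideal_def algebra_ideal_generated_def by blast

lemmas lpa_ideal_closed = algebra_ideal_lpa_ideal[unfolded algebra_ideal_free_algebra]

lemma lpa_ideal_words: "p \<in> lpa_ideal G \<Longrightarrow> p \<in> lpa_words G"
  using lpa_ideal_closed by blast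

lemma lpa_ideal_add: "p \<in> lpa_ideal G \<Longrightarrow> q \<in> lpa_ideal G \<Longrightarrow> p + q \<in> lpa_ideal G"
  using lpa_ideal_closed by blast

lemma lpa_ideal_diff: "p \<in> lpa_ideal G \<Longrightarrow> q \<in> lpa_ideal G \<Longrightarrow> p - q \<in> lpa_ideal G"
proof -
  assume pq: "p \<in> lpa_ideal G" "q \<in> lpa_ideal G"
  have "p + scalar (- 1) * q \<in> lpa_ideal G" using lpa_ideal_closed pq by blast
  moreover have "p + scalar (- 1) * q = p - q"
    by (rule poly_mapping_eqI) (simp add: lookup_scalar_mult lookup_add lookup_minus)
  ultimately show ?thesis by simp
qed

lemma lpa_ideal_sum: "(\<And>i. i \<in> I \<Longrightarrow> p i \<in> lpa_ideal G) \<Longrightarrow> (\<Sum>i\<in>I. p i) \<in> lpa_ideal G"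
  by (induction I rule: infinite_finite_induct) (use lpa_ideal_closed in auto)

text \<open>To work in a ring with unit, the ideal of relations is extended to all combinations of
  words, by sending the words that contain foreign letters to zero.\<close>

definition proj :: "(('a, 'b) lpa_gen list \<Rightarrow>\<^sub>0 'k::field) \<Rightarrow> (('a, 'b) lpa_gen list \<Rightarrow>\<^sub>0 'k)" where
  "proj = linear_ext (\<lambda>w c. if set w \<subseteq> lpa_gens G then single w c else 0)"

definition relation_ideal :: "(('a, 'b) lpa_gen list \<Rightarrow>\<^sub>0 'k::field) set" where
  "relation_ideal = {p. proj p \<in> lpa_ideal G}"

lemma proj_diff: "proj (p - q) = proj p - proj q"
  unfolding proj_def by (rule linear_ext_diff) (simp add: single_add)

lemma proj_zero: "proj 0 = 0"
  unfolding proj_def by (rule linear_ext_zero) (simp add: single_add)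

text \<open>A concatenation contains a foreign letter exactly if one of its factors does.\<close>

lemma proj_mult: "proj (p * q) = proj p * proj q"
  unfolding proj_def by (rule linear_ext_mult) (auto simp: single_add word_mult)

lemma proj_words:
  assumes "p \<in> lpa_words G"
  shows "proj p = p"
proof -
  have "proj p = (\<Sum>w\<in>keys p. single w (lookup p w))"
    unfolding proj_def linear_ext_def using assms by (intro sum.cong) (auto simp: words_over_def)
  then show ?thesis using poly_mapping_sum_single[of p] by simp
qed

text \<open>With the constant term split off, multiplication by an arbitrary ring element reduces to
  scalars and elements of the free algebra without unit, and \<open>lpa_ideal G\<close> is closed
  under both.\<close>

lemma proj_decomp:
  fixes p :: "_ \<Rightarrow>\<^sub>0 'k::field"
  obtains c q where "q \<in> lpa_words G" "proj p = scalar c + q"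
proof -
  define q where "q = proj p - scalar (lookup (proj p) [])"
  have "q \<in> lpa_words G"
    unfolding words_over_def
  proof (intro CollectI ballI conjI)
    fix w assume w: "w \<in> keys q"
    then show "w \<noteq> []" by (auto simp: q_def in_keys_iff lookup_minus)
    have "keys (proj p) \<subseteq> (\<Union>w\<in>keys p. keys (if set w \<subseteq> lpa_gens G then single w (lookup p w) else 0))"
      unfolding proj_def linear_ext_def by (rule keys_sum)
    moreover have "keys (if set w \<subseteq> lpa_gens G then single w c else 0) \<subseteq> {w. set w \<subseteq> lpa_gens G}"
      for w and c :: 'k
      by auto
    ultimately have "keys (proj p) \<subseteq> {w. set w \<subseteq> lpa_gens G}" by blast
    moreover have "w \<in> keys (proj p) \<or> w = []"
      using w by (auto simp: q_def in_keys_iff lookup_minus lookup_single when_def split: if_splits)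
    ultimately show "set w \<subseteq> lpa_gens G" by auto
  qed
  moreover have "proj p = scalar (lookup (proj p) []) + q" by (simp add: q_def)
  ultimately show ?thesis by (rule that)
qed

lemma relation_ideal_iff: "p \<in> lpa_words G \<Longrightarrow> p \<in> relation_ideal \<longleftrightarrow> p \<in> lpa_ideal G"
  by (simp add: relation_ideal_def proj_words)

lemma lpa_ideal_relation_ideal: "p \<in> lpa_ideal G \<Longrightarrow> p \<in> relation_ideal"
  using relation_ideal_iff lpa_ideal_words by blast

sublocale relations: ring_ideal "relation_ideal :: (('a, 'b) lpa_gen list \<Rightarrow>\<^sub>0 'k::field) set"
proof
  show "0 \<in> relation_ideal" using lpa_ideal_closed by (auto simp: relation_ideal_def proj_zero)
next
  fix p q :: "('a, 'b) lpa_gen list \<Rightarrow>\<^sub>0 'k"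
  assume "p \<in> relation_ideal" "q \<in> relation_ideal"
  then show "p - q \<in> relation_ideal" by (simp add: relation_ideal_def proj_diff lpa_ideal_diff)
next
  fix p z :: "('a, 'b) lpa_gen list \<Rightarrow>\<^sub>0 'k"
  assume "p \<in> relation_ideal"
  then have p: "proj p \<in> lpa_ideal G" by (simp add: relation_ideal_def)
  obtain q c where q: "q \<in> lpa_words G" "proj z = scalar c + q" by (rule proj_decomp)
  have "scalar c * proj p + q * proj p \<in> lpa_ideal G" "scalar c * proj p + proj p * q \<in> lpa_ideal G"
    using lpa_ideal_closed p q(1) by blast+
  then show "z * p \<in> relation_ideal" "p * z \<in> relation_ideal"
    by (simp_all add: relation_ideal_def proj_mult q(2) distrib_left distrib_right scalar_central)
qed

notation relations.cong (infix \<open>\<approx>\<close> 50)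

lemma relator_cong: "p - q \<in> lpa_relators G \<Longrightarrow> p \<approx> q"
  using relators_lpa_ideal lpa_ideal_relation_ideal unfolding relations.cong_def by blast

section \<open>The defining relations as congruences\<close>

lemma vx_vx: "v \<in> verts G \<Longrightarrow> w \<in> verts G \<Longrightarrow> vx v * vx w \<approx> (if v = w then vx v else 0)"
  by (rule relator_cong) (auto simp: lpa_relators_def word_mult)

lemma vx_ed: "e \<in> arcs G \<Longrightarrow> vx (tail G e) * ed e \<approx> ed e"
  by (rule relator_cong) (auto simp: lpa_relators_def word_mult)

lemma ed_vx: "e \<in> arcs G \<Longrightarrow> ed e * vx (head G e) \<approx> ed e"
  by (rule relator_cong) (auto simp: lpa_relators_def word_mult)

lemma vx_gh: "e \<in> arcs G \<Longrightarrow> vx (head G e) * gh e \<approx> gh e"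
  by (rule relator_cong) (auto simp: lpa_relators_def word_mult)

lemma gh_vx: "e \<in> arcs G \<Longrightarrow> gh e * vx (tail G e) \<approx> gh e"
  by (rule relator_cong) (auto simp: lpa_relators_def word_mult)

lemma gh_ed: "e \<in> arcs G \<Longrightarrow> f \<in> arcs G \<Longrightarrow> gh e * ed f \<approx> (if e = f then vx (head G f) else 0)"
  by (rule relator_cong) (auto simp: lpa_relators_def word_mult)

lemma vx_sum:
  assumes "regular_vertex G v"
  shows "vx v \<approx> (\<Sum>e\<in>out_arcs G v. ed e * gh e)"
proof (rule relator_cong)
  have "vx v - (\<Sum>e\<in>out_arcs G v. word [Edge e, Ghost e]) \<in> lpa_relators G"
    unfolding lpa_relators_def using assms by blast
  then show "vx v - (\<Sum>e\<in>out_arcs G v. ed e * gh e) \<in> lpa_relators G" by (simp add: word_mult)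
qed

end

section \<open>A representation by partial injections\<close>

context countable_digraph
begin

text \<open>States are triples of a vertex, a point of the set \<open>nat\<close> attached to the vertex and a degree. The edges
  leaving \<open>v\<close> are sent to injections of \<open>nat\<close> whose ranges partition \<open>nat\<close>.\<close>

definition branching :: "('b \<Rightarrow> nat \<Rightarrow> nat) \<Rightarrow> bool" where
  "branching enc \<longleftrightarrow> (\<forall>e\<in>arcs E. inj (enc e)) \<and>
     (\<forall>e\<in>arcs E. \<forall>f\<in>arcs E. tail E e = tail E f \<longrightarrow> e \<noteq> f \<longrightarrow> range (enc e) \<inter> range (enc f) = {}) \<and>
     (\<forall>v k. out_arcs E v \<noteq> {} \<longrightarrow> (\<exists>e\<in>out_arcs E v. k \<in> range (enc e)))"

text \<open>If \<open>v\<close> emits an edge, the product of its outgoing edges with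
  \<open>nat\<close> is countably infinite, also for infinitely many edges. A bijection of this
  product with \<open>nat\<close> restricts to the injections of the single edges.\<close>

lemma branching_exists: "\<exists>enc. branching enc"
proof -
  have "\<exists>h. bij_betw h (out_arcs E v \<times> (UNIV :: nat set)) (UNIV :: nat set)"
    if ne: "out_arcs E v \<noteq> {}" for v
  proof -
    have "countable (out_arcs E v)"
      using countable_arcs by (rule countable_subset[rotated]) (auto simp: out_arcs_def)
    then have "countable (out_arcs E v \<times> (UNIV :: nat set))" by (intro countable_SIGMA) auto
    moreover have "infinite (out_arcs E v \<times> (UNIV :: nat set))"
      using ne by (simp add: finite_cartesian_product_iff)
    ultimately have "bij_betw (to_nat_on (out_arcs E v \<times> (UNIV :: nat set))) (out_arcs E v \<times> UNIV) UNIV"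
      by (rule to_nat_on_infinite)
    then show ?thesis by (intro exI)
  qed
  then obtain h where h: "\<And>v. out_arcs E v \<noteq> {} \<Longrightarrow>
      bij_betw (h v) (out_arcs E v \<times> (UNIV :: nat set)) (UNIV :: nat set)"
    by metis
  define enc where "enc e k = h (tail E e) (e, k)" for e k
  have inj: "(e, k) = (f, l)"
    if "e \<in> arcs E" "f \<in> arcs E" "tail E e = tail E f" "enc e k = enc f l" for e f k l
  proof -
    have ef: "e \<in> out_arcs E (tail E e)" "f \<in> out_arcs E (tail E e)" using that by auto
    then have "inj_on (h (tail E e)) (out_arcs E (tail E e) \<times> UNIV)"
      using bij_betw_imp_inj_on[OF h] by blast
    moreover have "h (tail E e) (e, k) = h (tail E e) (f, l)" using that(3,4) by (simp add: enc_def)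
    ultimately show ?thesis by (rule inj_onD) (use ef in auto)
  qed
  have "branching enc"
    unfolding branching_def
  proof (intro conjI ballI allI impI)
    show "inj (enc e)" if "e \<in> arcs E" for e using inj that by (auto simp: inj_def)
    show "range (enc e) \<inter> range (enc f) = {}"
      if "e \<in> arcs E" "f \<in> arcs E" "tail E e = tail E f" "e \<noteq> f" for e f
      using inj that by blast
    show "\<exists>e\<in>out_arcs E v. k \<in> range (enc e)" if ne: "out_arcs E v \<noteq> {}" for v k
    proof -
      have "k \<in> h v ` (out_arcs E v \<times> UNIV)" using bij_betw_imp_surj_on[OF h[OF ne]] by simp
      then obtain e l where "e \<in> out_arcs E v" "k = h v (e, l)" by blast
      then show ?thesis by (intro bexI[of _ e]) (auto simp: enc_def)
    qed
  qed
  then show ?thesis by blast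
qed

definition enc :: "'b \<Rightarrow> nat \<Rightarrow> nat" where "enc = (SOME enc. branching enc)"

lemma branching_enc: "branching enc"
  unfolding enc_def using branching_exists by (rule someI_ex)

lemma inj_enc: "e \<in> arcs E \<Longrightarrow> inj (enc e)"
  using branching_enc by (simp add: branching_def)

lemma enc_disjoint:
  "e \<in> arcs E \<Longrightarrow> f \<in> arcs E \<Longrightarrow> tail E e = tail E f \<Longrightarrow> k \<in> range (enc e) \<Longrightarrow> k \<in> range (enc f) \<Longrightarrow> e = f"
  using branching_enc unfolding branching_def by blast

lemma enc_cover: "out_arcs E v \<noteq> {} \<Longrightarrow> \<exists>e\<in>out_arcs E v. k \<in> range (enc e)"
  using branching_enc unfolding branching_def by blast

text \<open>The integer prevents a cycle from fixing a state, which vertex and point alone would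
  permit.\<close>

fun gen_act :: "('a, 'b) lpa_gen \<Rightarrow> 'a \<times> nat \<times> int \<Rightarrow> ('a \<times> nat \<times> int) option" where
  "gen_act (Vertex v) (u, k, n) = (if u = v then Some (u, k, n) else None)"
| "gen_act (Edge e) (u, k, n) = (if u = head E e then Some (tail E e, enc e k, n + 1) else None)"
| "gen_act (Ghost e) (u, k, n) =
    (if u = tail E e \<and> k \<in> range (enc e) then Some (head E e, the_inv (enc e) k, n - 1) else None)"

primrec word_act :: "('a, 'b) lpa_gen list \<Rightarrow> 'a \<times> nat \<times> int \<Rightarrow> ('a \<times> nat \<times> int) option" where
  "word_act [] x = Some x"
| "word_act (g # w) x = Option.bind (word_act w x) (gen_act g)"

lemma word_act_append: "word_act (u @ w) x = Option.bind (word_act w x) (word_act u)"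
  by (induction u) (auto simp: bind_assoc split: Option.bind_split)

text \<open>Words act on functions by composition with partial injections, undefined values counting
  as \<open>0\<close>. This reverses products (see \<open>act_mult\<close>), which is harmless
  because only the kernel matters.\<close>

definition act :: "(('a, 'b) lpa_gen list \<Rightarrow>\<^sub>0 'k::field) \<Rightarrow> ('a \<times> nat \<times> int \<Rightarrow> 'k) \<Rightarrow> 'a \<times> nat \<times> int \<Rightarrow> 'k" where
  "act f \<phi> x = linear_ext (\<lambda>w c. case word_act w x of None \<Rightarrow> 0 | Some y \<Rightarrow> c * \<phi> y) f"

lemma act_term_add:
  "(case word_act w x of None \<Rightarrow> 0 | Some y \<Rightarrow> (c + d) * \<phi> y) =
    (case word_act w x of None \<Rightarrow> 0 | Some y \<Rightarrow> c * \<phi> y) +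
    (case word_act w x of None \<Rightarrow> 0 | Some y \<Rightarrow> d * (\<phi> y :: 'k::field))"
  by (simp add: distrib_right split: option.split)

lemma act_zero: "act 0 \<phi> x = 0"
  unfolding act_def by (rule linear_ext_zero) (rule act_term_add)

lemma act_single: "act (single w c) \<phi> x = (case word_act w x of None \<Rightarrow> 0 | Some y \<Rightarrow> c * \<phi> y)"
  unfolding act_def by (rule linear_ext_single) (rule act_term_add)

lemma act_add: "act (f + g) \<phi> x = act f \<phi> x + act g \<phi> x"
  unfolding act_def by (rule linear_ext_add) (rule act_term_add)

lemma act_diff: "act (f - g) \<phi> x = act f \<phi> x - act g \<phi> x"
  unfolding act_def by (rule linear_ext_diff) (rule act_term_add)

lemma act_sum: "act (\<Sum>i\<in>I. f i) \<phi> x = (\<Sum>i\<in>I. act (f i) \<phi> x)"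
  unfolding act_def by (rule linear_ext_sum) (rule act_term_add)

lemma act_null: "act f (\<lambda>_. 0) x = 0"
  unfolding act_def linear_ext_def by (rule sum.neutral) (simp split: option.split)

lemma act_fun_add: "act f (\<lambda>y. \<phi> y + \<psi> y) x = act f \<phi> x + act f \<psi> x"
  unfolding act_def linear_ext_def sum.distrib[symmetric]
  by (rule sum.cong) (auto simp: distrib_left split: option.split)

lemma act_mult: "act (f * g) \<phi> x = act g (act f \<phi>) x"
proof (induction f rule: poly_mapping_single_induct)
  case zero
  have "act 0 \<phi> = (\<lambda>_. 0)" by (simp add: act_zero fun_eq_iff)
  then show ?case by (simp add: act_zero act_null)
next
  case (add u f')
  have single: "act (single u c * g) \<phi> x = act g (act (single u c) \<phi>) x" for c
  proof (induction g rule: poly_mapping_single_induct)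
    case (add w g')
    then show ?case
      by (simp add: distrib_left act_add word_mult act_single word_act_append split: option.split Option.bind_split)
  qed (simp add: act_zero)
  have "act (single u (lookup f u) + f') \<phi> = (\<lambda>y. act (single u (lookup f u)) \<phi> y + act f' \<phi> y)"
    by (simp add: act_add fun_eq_iff)
  then show ?case using add by (simp add: distrib_right act_add act_fun_add single)
qed

lemma act_scalar: "act (scalar c * f) \<phi> x = c * act f \<phi> x"
proof (induction f rule: poly_mapping_single_induct)
  case (add w f')
  then show ?case
    by (simp add: distrib_left act_add word_mult act_single split: option.split)
qed (simp add: act_zero)

lemma act_edge_ghost:
  assumes "e \<in> arcs E"
  shows "act (word [Edge e, Ghost e]) \<phi> (u, k, n) =
    (if u = tail E e \<and> k \<in> range (enc e) then \<phi> (u, k, n) else 0)"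
  using f_the_inv_into_f[OF inj_enc[OF assms], of k] by (simp add: act_single)

text \<open>(CK1) reflects that the maps \<open>enc e\<close> are injective with disjoint ranges.
  For (CK2), each product of an edge with its ghost is the projection onto one range, and the ranges
  at a regular vertex cover each point exactly once.\<close>

lemma act_relators:
  assumes "p \<in> lpa_relators E"
  shows "act p \<phi> x = 0"
proof -
  obtain u k n where x: "x = (u, k, n)" by (cases x) auto
  have ghost_edge: "act (word [Ghost e, Edge f] - (if e = f then vx (head E f) else 0)) \<phi> x = 0"
    if "e \<in> arcs E" "f \<in> arcs E" for e f
    using that inj_enc[of f] enc_disjoint[of e f "enc f k"]
    by (auto simp: x act_diff act_single act_zero the_inv_f_f)
  have regular: "act (vx v - (\<Sum>e\<in>out_arcs E v. word [Edge e, Ghost e])) \<phi> x = 0"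
    if "regular_vertex E v" for v
  proof (cases "u = v")
    case True
    have fin: "finite (out_arcs E v)" "out_arcs E v \<noteq> {}" using that by (auto simp: regular_vertex_def)
    then obtain e where e: "e \<in> out_arcs E v" "k \<in> range (enc e)" using enc_cover by blast
    have "act (word [Edge f, Ghost f]) \<phi> x = (if f = e then \<phi> x else 0)" if f: "f \<in> out_arcs E v" for f
    proof (cases "f = e")
      case False
      then have "k \<notin> range (enc f)" using enc_disjoint[of e f k] e f by auto
      then show ?thesis using False f by (simp add: x act_edge_ghost)
    qed (use e True in \<open>simp add: x act_edge_ghost\<close>)
    then have "(\<Sum>f\<in>out_arcs E v. act (word [Edge f, Ghost f]) \<phi> x) = \<phi> x"
      using fin(1) e(1) by simp
    then show ?thesis using True by (simp add: x act_diff act_sum act_single)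
  next
    case False
    then have "act (word [Edge f, Ghost f]) \<phi> x = 0" if "f \<in> out_arcs E v" for f
      using that by (auto simp: x act_edge_ghost)
    then show ?thesis using False by (simp add: x act_diff act_sum act_single)
  qed
  from assms consider
      (vertices) v w where "p = word [Vertex v, Vertex w] - (if v = w then word [Vertex v] else 0)"
    | (edge) e where "p = word [Vertex (tail E e), Edge e] - word [Edge e] \<or>
        p = word [Edge e, Vertex (head E e)] - word [Edge e]"
    | (ghost) e where "p = word [Vertex (head E e), Ghost e] - word [Ghost e] \<or>
        p = word [Ghost e, Vertex (tail E e)] - word [Ghost e]"
    | (ghost_edge) e f where "e \<in> arcs E" "f \<in> arcs E"
        "p = word [Ghost e, Edge f] - (if e = f then vx (head E f) else 0)"
    | (regular) v where "regular_vertex E v"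
        "p = vx v - (\<Sum>e\<in>out_arcs E v. word [Edge e, Ghost e])"
    unfolding lpa_relators_def by blast
  then show ?thesis
  proof cases
    case vertices
    then show ?thesis by (auto simp: x act_diff act_single act_zero)
  next
    case edge
    then show ?thesis by (auto simp: x act_diff act_single)
  next
    case ghost
    then show ?thesis by (auto simp: x act_diff act_single)
  qed (use ghost_edge regular in blast)+
qed

text \<open>The elements that annihilate all functions form an algebra ideal, and the relators
  belong to it.\<close>

lemma act_lpa_ideal:
  fixes p :: "('a, 'b) lpa_gen list \<Rightarrow>\<^sub>0 'c::field"
  assumes "p \<in> lpa_ideal E"
  shows "act p \<phi> x = 0"
proof -
  define K where "K = {p \<in> lpa_words E. \<forall>\<phi> x. act p \<phi> x = (0 :: 'c)}"
  have "lpa_relators E \<subseteq> K" using relators_words act_relators by (auto simp: K_def)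
  moreover have "algebra_ideal K (free_algebra (lpa_gens E))"
    unfolding algebra_ideal_free_algebra
  proof (intro conjI ballI allI)
    fix p q :: "('a, 'b) lpa_gen list \<Rightarrow>\<^sub>0 'c" assume pq: "p \<in> K" "q \<in> lpa_words E"
    then have "act p \<phi> = (\<lambda>_. 0)" for \<phi> by (auto simp: K_def)
    then show "q * p \<in> K" "p * q \<in> K"
      using pq by (auto simp: K_def act_mult act_null intro: words_over_mult)
  qed (auto simp: K_def act_zero act_add act_scalar words_over_zero intro: words_over_add words_over_scalar)
  ultimately have "lpa_ideal E \<subseteq> K" by (intro lpa_ideal_subset)
  then show ?thesis using assms unfolding K_def by blast
qed

section \<open>The grading by path length\<close>

primrec gen_degree :: "('a, 'b) lpa_gen \<Rightarrow> int" where
  "gen_degree (Vertex v) = 0"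
| "gen_degree (Edge e) = 1"
| "gen_degree (Ghost e) = - 1"

definition homogeneous :: "int \<Rightarrow> (('a, 'b) lpa_gen list \<Rightarrow>\<^sub>0 'k::field) set" where
  "homogeneous d = {p. \<forall>w\<in>keys p. sum_list (map gen_degree w) = d}"

lemma homogeneous_zero: "0 \<in> homogeneous d"
  by (simp add: homogeneous_def)

lemma homogeneous_single: "sum_list (map gen_degree w) = d \<Longrightarrow> single w c \<in> homogeneous d"
  by (simp add: homogeneous_def)

lemma homogeneous_add: "p \<in> homogeneous d \<Longrightarrow> q \<in> homogeneous d \<Longrightarrow> p + q \<in> homogeneous d"
  using keys_add[of p q] unfolding homogeneous_def by blast

lemma homogeneous_diff: "p \<in> homogeneous d \<Longrightarrow> q \<in> homogeneous d \<Longrightarrow> p - q \<in> homogeneous d"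
  using homogeneous_add[of p d "- q"] unfolding homogeneous_def by (simp add: in_keys_iff)

lemma homogeneous_sum: "(\<And>i. i \<in> I \<Longrightarrow> f i \<in> homogeneous d) \<Longrightarrow> (\<Sum>i\<in>I. f i) \<in> homogeneous d"
  by (induction I rule: infinite_finite_induct) (auto intro: homogeneous_zero homogeneous_add)

lemma homogeneous_mult: "p \<in> homogeneous d \<Longrightarrow> q \<in> homogeneous d' \<Longrightarrow> p * q \<in> homogeneous (d + d')"
  unfolding homogeneous_def by (fastforce elim!: keys_mult_words)

lemma gen_act_degree: "gen_act g (u, k, n) = Some (u', k', n') \<Longrightarrow> n' = n + gen_degree g"
  by (cases g) (auto split: if_splits)

lemma word_act_degree:
  "word_act w (u, k, n) = Some (u', k', n') \<Longrightarrow> n' = n + sum_list (map gen_degree w)"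
  by (induction w arbitrary: u' k' n') (auto simp: Option.bind_eq_Some_conv dest!: gen_act_degree)

text \<open>A word of nonzero degree changes the integer of every state, so the diagonal entry at
  \<open>x\<close> vanishes.\<close>

lemma act_homogeneous:
  assumes "p \<in> homogeneous d" "d \<noteq> 0"
  shows "act p (\<lambda>y. if y = x then 1 else 0) x = (0 :: 'k::field)"
  unfolding act_def linear_ext_def
proof (rule sum.neutral, rule ballI)
  fix w assume "w \<in> keys p"
  then have "sum_list (map gen_degree w) \<noteq> 0" using assms by (auto simp: homogeneous_def)
  then have "word_act w x \<noteq> Some x" using word_act_degree by (cases x) force
  then show "(case word_act w x of None \<Rightarrow> 0
      | Some y \<Rightarrow> lookup p w * (if y = x then 1 else 0)) = 0"
    by (auto split: option.split)
qed

end

section \<open>Finite subgraphs\<close>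

text \<open>A vertex \<open>v\<close> of a finite subgraph is split into the range projection of the chosen edges leaving it
  and the complement of this projection. The complement is dropped if all edges leaving \<open>v\<close> are
  chosen, as it is then \<open>0\<close> by the relation (CK2). The parts form a Leavitt family.\<close>

locale finite_subgraph = countable_digraph E for E :: "('v, 'e) pre_digraph" +
  fixes Vs :: "'v set" and F :: "'e set" and K :: "'k::field itself"
  assumes finite_Vs: "finite Vs" and finite_F: "finite F"
    and Vs_verts: "Vs \<subseteq> verts E" and F_arcs: "F \<subseteq> arcs E"
    and tail_Vs: "e \<in> F \<Longrightarrow> tail E e \<in> Vs" and head_Vs: "e \<in> F \<Longrightarrow> head E e \<in> Vs"
begin



definition rng :: "'v \<Rightarrow> (('v, 'e) lpa_gen list \<Rightarrow>\<^sub>0 'k)" where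
  "rng v = (\<Sum>e | e \<in> F \<and> tail E e = v. ed e * gh e)"

definition part :: "'v \<Rightarrow> bool \<Rightarrow> (('v, 'e) lpa_gen list \<Rightarrow>\<^sub>0 'k)" where
  "part v b = (if b then rng v else vx v - rng v)"

text \<open>At a sink of \<open>E\<close> there is no (CK2), and \<open>(v, False)\<close> is the
  vertex itself. A vertex with infinitely many outgoing edges always keeps this part, since
  \<open>F\<close> is finite.\<close>

definition sub_verts :: "('v \<times> bool) set" where
  "sub_verts = {(v, b). v \<in> Vs \<and>
     (if b then \<exists>e\<in>F. tail E e = v else out_arcs E v = {} \<or> \<not> out_arcs E v \<subseteq> F)}"

text \<open>Since \<open>e\<close> equals \<open>e\<close> times its range, it splits into one copy
  for each part of the range. All copies start in the part \<open>True\<close>, as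
  \<open>rng\<close> fixes \<open>e\<close> from the left; so the parts \<open>False\<close> are
  sinks.\<close>

definition sub_arcs :: "('e \<times> bool) set" where
  "sub_arcs = {(e, b). e \<in> F \<and> (head E e, b) \<in> sub_verts}"

definition sub_tail :: "'e \<times> bool \<Rightarrow> 'v \<times> bool" where "sub_tail x = (tail E (fst x), True)"
definition sub_head :: "'e \<times> bool \<Rightarrow> 'v \<times> bool" where "sub_head x = (head E (fst x), snd x)"

text \<open>The default \<open>0\<close> lets sums run over both parts of every vertex, whether or
  not they are present.\<close>

definition sub_P :: "'v \<times> bool \<Rightarrow> (('v, 'e) lpa_gen list \<Rightarrow>\<^sub>0 'k)" where
  "sub_P a = (if a \<in> sub_verts then part (fst a) (snd a) else 0)"

definition sub_A :: "'e \<times> bool \<Rightarrow> (('v, 'e) lpa_gen list \<Rightarrow>\<^sub>0 'k)" where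
  "sub_A x = (if x \<in> sub_arcs then ed (fst x) * sub_P (sub_head x) else 0)"

definition sub_G :: "'e \<times> bool \<Rightarrow> (('v, 'e) lpa_gen list \<Rightarrow>\<^sub>0 'k)" where
  "sub_G x = (if x \<in> sub_arcs then sub_P (sub_head x) * gh (fst x) else 0)"

lemma F_arc: "e \<in> F \<Longrightarrow> e \<in> arcs E" using F_arcs by blast

lemma Vs_vert: "v \<in> Vs \<Longrightarrow> v \<in> verts E" using Vs_verts by blast

lemma vx_idem: "v \<in> Vs \<Longrightarrow> vx v * vx v \<approx> (vx v :: ('v, 'e) lpa_gen list \<Rightarrow>\<^sub>0 'k)"
  using vx_vx[of v v] Vs_vert by simp

section \<open>The parts of the vertices as orthogonal idempotents\<close>

lemma vx_rng: "vx v * rng v \<approx> rng v"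
  unfolding rng_def sum_distrib_left mult.assoc[symmetric]
  by (intro relations.cong_sum relations.cong_right) (auto dest: F_arc intro: vx_ed)

lemma rng_vx: "rng v * vx v \<approx> rng v"
  unfolding rng_def sum_distrib_right mult.assoc
  by (intro relations.cong_sum relations.cong_left) (auto dest: F_arc intro: gh_vx)

lemma rng_ed:
  assumes "e \<in> F"
  shows "rng (tail E e) * ed e \<approx> ed e"
proof -
  have "rng (tail E e) * ed e = (\<Sum>f | f \<in> F \<and> tail E f = tail E e. ed f * (gh f * ed e))"
    by (simp add: rng_def sum_distrib_right mult.assoc)
  also have "\<dots> \<approx> (\<Sum>f | f \<in> F \<and> tail E f = tail E e. ed f * (if f = e then vx (head E e) else 0))"
    using assms by (intro relations.cong_sum relations.cong_left gh_ed) (auto dest: F_arc)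
  also have "\<dots> = (\<Sum>f | f \<in> F \<and> tail E f = tail E e. if f = e then ed e * vx (head E e) else 0)"
    by (rule sum.cong) auto
  also have "\<dots> = ed e * vx (head E e)"
    using assms finite_F by (subst sum.delta) auto
  also have "\<dots> \<approx> ed e" by (rule ed_vx[OF F_arc[OF assms]])
  finally show ?thesis .
qed

lemma gh_rng:
  assumes "e \<in> F"
  shows "gh e * rng (tail E e) \<approx> gh e"
proof -
  have "gh e * rng (tail E e) = (\<Sum>f | f \<in> F \<and> tail E f = tail E e. gh e * ed f * gh f)"
    by (simp add: rng_def sum_distrib_left mult.assoc)
  also have "\<dots> \<approx> (\<Sum>f | f \<in> F \<and> tail E f = tail E e. (if e = f then vx (head E f) else 0) * gh f)"
    using assms by (intro relations.cong_sum relations.cong_right gh_ed) (auto dest: F_arc)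
  also have "\<dots> = (\<Sum>f | f \<in> F \<and> tail E f = tail E e. if f = e then vx (head E e) * gh e else 0)"
    by (rule sum.cong) auto
  also have "\<dots> = vx (head E e) * gh e"
    using assms finite_F by (subst sum.delta) auto
  also have "\<dots> \<approx> gh e" by (rule vx_gh[OF F_arc[OF assms]])
  finally show ?thesis .
qed

lemma rng_rng: "rng v * rng v \<approx> rng v"
proof -
  have "rng v * rng v = (\<Sum>e | e \<in> F \<and> tail E e = v. ed e * (gh e * rng v))"
    by (subst (1) rng_def) (simp add: sum_distrib_right mult.assoc)
  also have "\<dots> \<approx> (\<Sum>e | e \<in> F \<and> tail E e = v. ed e * gh e)"
    by (intro relations.cong_sum relations.cong_left) (auto intro: gh_rng)
  finally show ?thesis by (simp add: rng_def)
qed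

lemma vx_part: "v \<in> Vs \<Longrightarrow> vx v * part v b \<approx> part v b"
  using relations.cong_diff[OF vx_idem vx_rng, of v v] vx_rng[of v]
  by (simp add: part_def right_diff_distrib)

lemma part_vx: "v \<in> Vs \<Longrightarrow> part v b * vx v \<approx> part v b"
  using relations.cong_diff[OF vx_idem rng_vx, of v v] rng_vx[of v]
  by (simp add: part_def left_diff_distrib)

lemma part_part_same:
  assumes "v \<in> Vs"
  shows "part v b * part v b' \<approx> (if b = b' then part v b else 0)"
proof -
  have 1: "rng v * (vx v - rng v) \<approx> 0"
    using relations.cong_diff[OF rng_vx rng_rng, of v v] by (simp add: right_diff_distrib)
  have 2: "(vx v - rng v) * rng v \<approx> 0"
    using relations.cong_diff[OF vx_rng rng_rng, of v v] by (simp add: left_diff_distrib)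
  have 3: "(vx v - rng v) * (vx v - rng v) \<approx> vx v - rng v"
    using relations.cong_diff[OF part_vx[OF assms, of False] 2]
    by (simp add: part_def right_diff_distrib)
  show ?thesis using 1 2 3 rng_rng by (cases b; cases b') (simp_all add: part_def)
qed

lemma part_part_other:
  assumes "v \<in> Vs" "w \<in> Vs" "v \<noteq> w"
  shows "part v b * part w b' \<approx> 0"
proof -
  have "part v b * part w b' \<approx> part v b * vx v * (vx w * part w b')"
    by (intro relations.cong_mult relations.cong_sym[OF part_vx] relations.cong_sym[OF vx_part] assms)
  also have "\<dots> = part v b * (vx v * vx w) * part w b'" by (simp add: mult.assoc)
  also have "\<dots> \<approx> part v b * 0 * part w b'"
    using vx_vx[OF Vs_vert[OF assms(1)] Vs_vert[OF assms(2)]] assms(3)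
    by (intro relations.cong_right relations.cong_left) simp
  finally show ?thesis by simp
qed

text \<open>Absent parts are \<open>0\<close> anyway: \<open>rng v\<close> is an empty sum if no
  chosen edge leaves \<open>v\<close>, and the complement vanishes by (CK2) if \<open>v\<close>
  emits edges and all of them are chosen.\<close>

lemma sub_P_sum:
  assumes "v \<in> Vs"
  shows "sub_P (v, True) + sub_P (v, False) \<approx> vx v"
proof -
  have "sub_P (v, True) = rng v"
  proof (cases "(v, True) \<in> sub_verts")
    case False
    then have "{e. e \<in> F \<and> tail E e = v} = {}" using assms by (auto simp: sub_verts_def)
    then have "rng v = 0" unfolding rng_def by (simp only: sum.empty)
    then show ?thesis using False by (simp add: sub_P_def)
  qed (simp add: sub_P_def part_def)
  moreover have "sub_P (v, False) \<approx> vx v - rng v"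
  proof (cases "(v, False) \<in> sub_verts")
    case False
    then have out: "out_arcs E v \<noteq> {}" "out_arcs E v \<subseteq> F" using assms by (auto simp: sub_verts_def)
    then have "regular_vertex E v"
      using assms Vs_vert finite_F finite_subset by (auto simp: regular_vertex_def)
    then have "vx v \<approx> (\<Sum>e\<in>out_arcs E v. ed e * gh e)" by (rule vx_sum)
    moreover have "out_arcs E v = {e. e \<in> F \<and> tail E e = v}" using out(2) F_arcs by auto
    ultimately have "vx v \<approx> rng v" by (simp add: rng_def)
    then have "0 \<approx> vx v - rng v" by (intro relations.cong_sym[of _ 0]) (simp add: relations.cong_def)
    then show ?thesis using False by (simp add: sub_P_def)
  qed (simp add: sub_P_def part_def)
  ultimately show ?thesis
    using relations.cong_add[OF relations.cong_refl[of "rng v"], of "sub_P (v, False)" "vx v - rng v"]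
    by simp
qed

lemma sub_P_sub_P:
  assumes "a \<in> sub_verts" "b \<in> sub_verts"
  shows "sub_P a * sub_P b \<approx> (if a = b then sub_P a else 0)"
  using assms part_part_same[of "fst a" "snd a" "snd b"]
    part_part_other[of "fst a" "fst b" "snd a" "snd b"]
  by (cases a; cases b; cases "fst a = fst b") (auto simp: sub_P_def sub_verts_def)

lemma sub_head_verts: "x \<in> sub_arcs \<Longrightarrow> sub_head x \<in> sub_verts"
  by (auto simp: sub_arcs_def sub_head_def)

lemma sub_tail_verts: "x \<in> sub_arcs \<Longrightarrow> sub_tail x \<in> sub_verts"
  by (auto simp: sub_arcs_def sub_tail_def sub_verts_def tail_Vs)

lemma sub_P_tail: "x \<in> sub_arcs \<Longrightarrow> sub_P (sub_tail x) = rng (tail E (fst x))"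
  using sub_tail_verts[of x] by (simp add: sub_P_def sub_tail_def part_def)

sublocale family: leavitt_family "relation_ideal :: (('v, 'e) lpa_gen list \<Rightarrow>\<^sub>0 'k) set"
  sub_verts sub_arcs sub_tail sub_head scalar sub_P sub_A sub_G
proof
  show "finite sub_verts"
    by (rule finite_subset[of _ "Vs \<times> UNIV"]) (auto simp: sub_verts_def finite_Vs)
  show "finite sub_arcs"
    by (rule finite_subset[of _ "F \<times> UNIV"]) (auto simp: sub_arcs_def finite_F)
  show "scalar 1 = (1 :: _ \<Rightarrow>\<^sub>0 'k)" by (rule scalar_one)
  show "scalar (c + d) = scalar c + (scalar d :: _ \<Rightarrow>\<^sub>0 'k)" for c d by (rule single_add)
  show "scalar (c * d) = scalar c * (scalar d :: _ \<Rightarrow>\<^sub>0 'k)" for c d by (simp add: word_mult)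
  show "x * scalar c = scalar c * (x :: _ \<Rightarrow>\<^sub>0 'k)" for x c by (rule scalar_central)
  fix a b :: "'v \<times> bool"
  assume "a \<in> sub_verts" "b \<in> sub_verts"
  then show "sub_P a * (sub_P b :: _ \<Rightarrow>\<^sub>0 'k) \<approx> (if a = b then sub_P a else 0)" by (rule sub_P_sub_P)
next
  fix x assume x: "x \<in> sub_arcs"
  then have e: "fst x \<in> F" by (auto simp: sub_arcs_def)
  show "sub_tail x \<in> sub_verts" "sub_head x \<in> sub_verts" using x by (rule sub_tail_verts sub_head_verts)+
  have idem: "sub_P (sub_head x) * (sub_P (sub_head x) :: _ \<Rightarrow>\<^sub>0 'k) \<approx> sub_P (sub_head x)"
    using sub_P_sub_P[OF sub_head_verts sub_head_verts, OF x x] by simp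
  show "sub_P (sub_tail x) * (sub_A x :: _ \<Rightarrow>\<^sub>0 'k) \<approx> sub_A x"
    using relations.cong_right[OF rng_ed[OF e]] x
    by (simp add: sub_A_def sub_P_tail mult.assoc[symmetric])
  show "sub_A x * (sub_P (sub_head x) :: _ \<Rightarrow>\<^sub>0 'k) \<approx> sub_A x"
    using relations.cong_left[OF idem] x by (simp add: sub_A_def mult.assoc)
  show "sub_P (sub_head x) * (sub_G x :: _ \<Rightarrow>\<^sub>0 'k) \<approx> sub_G x"
    using relations.cong_right[OF idem] x by (simp add: sub_G_def mult.assoc[symmetric])
  show "sub_G x * (sub_P (sub_tail x) :: _ \<Rightarrow>\<^sub>0 'k) \<approx> sub_G x"
    using relations.cong_left[OF gh_rng[OF e]] x by (simp add: sub_G_def sub_P_tail mult.assoc)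
  fix y assume y: "y \<in> sub_arcs"
  then have f: "fst y \<in> F" by (auto simp: sub_arcs_def)
  have "sub_G x * (sub_A y :: _ \<Rightarrow>\<^sub>0 'k) =
      sub_P (sub_head x) * (gh (fst x) * ed (fst y)) * sub_P (sub_head y)"
    using x y by (simp add: sub_G_def sub_A_def mult.assoc)
  also have "\<dots> \<approx> sub_P (sub_head x) * (if fst x = fst y then vx (head E (fst y)) else 0) *
      sub_P (sub_head y)"
    by (intro relations.cong_right relations.cong_left gh_ed F_arc e f)
  also have "\<dots> \<approx> (if fst x = fst y then sub_P (sub_head x) * sub_P (sub_head y) else 0)"
    using relations.cong_left[OF vx_part[OF head_Vs[OF f]], of "sub_P (sub_head x)" "snd y"]
      sub_head_verts[OF y]
    by (auto simp: sub_P_def sub_head_def mult.assoc)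
  also have "\<dots> \<approx> (if x = y then sub_P (sub_head x) else 0)"
    using sub_P_sub_P[OF sub_head_verts[OF x] sub_head_verts[OF y]]
    by (cases x; cases y) (auto simp: sub_head_def)
  finally show "sub_G x * (sub_A y :: _ \<Rightarrow>\<^sub>0 'k) \<approx> (if x = y then sub_P (sub_head x) else 0)" .
next
  fix a :: "'v \<times> bool"
  assume a: "a \<in> sub_verts" "{x \<in> sub_arcs. sub_tail x = a} \<noteq> {}"
  then obtain v where v: "a = (v, True)" by (auto simp: sub_tail_def)
  \<comment> \<open>(CK2) at \<open>(v, True)\<close> is the definition of \<open>rng v\<close>,
    once the range of every edge is split into its parts.\<close>
  have "rng v \<approx> (\<Sum>e | e \<in> F \<and> tail E e = v. ed e * vx (head E e) * (gh e :: _ \<Rightarrow>\<^sub>0 'k))"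
    unfolding rng_def
    by (intro relations.cong_sum relations.cong_right relations.cong_sym[OF ed_vx]) (auto dest: F_arc)
  also have "\<dots> \<approx> (\<Sum>e | e \<in> F \<and> tail E e = v.
      ed e * (sub_P (head E e, True) + sub_P (head E e, False)) * gh e)"
    by (intro relations.cong_sum relations.cong_right relations.cong_left
        relations.cong_sym[OF sub_P_sum]) (auto intro: head_Vs)
  also have "\<dots> = (\<Sum>e | e \<in> F \<and> tail E e = v. \<Sum>b\<in>UNIV. ed e * sub_P (head E e, b) * gh e)"
    by (simp add: UNIV_bool distrib_left distrib_right add.commute)
  also have "\<dots> = (\<Sum>x\<in>{e. e \<in> F \<and> tail E e = v} \<times> UNIV. ed (fst x) * sub_P (sub_head x) * gh (fst x))"
    by (simp add: sum.cartesian_product sub_head_def split_def)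
  also have "\<dots> = (\<Sum>x | x \<in> sub_arcs \<and> sub_tail x = a. ed (fst x) * sub_P (sub_head x) * gh (fst x))"
    using finite_F v
    by (intro sum.mono_neutral_right) (auto simp: sub_arcs_def sub_tail_def sub_head_def sub_P_def)
  \<comment> \<open>The idempotent is doubled to provide one factor for \<open>sub_A\<close> and one
    for \<open>sub_G\<close>.\<close>
  also have "\<dots> \<approx> (\<Sum>x | x \<in> sub_arcs \<and> sub_tail x = a. ed (fst x) * (sub_P (sub_head x) * sub_P (sub_head x)) * gh (fst x))"
  proof (intro relations.cong_sum relations.cong_right relations.cong_left)
    fix x assume "x \<in> {x. x \<in> sub_arcs \<and> sub_tail x = a}"
    then show "sub_P (sub_head x) \<approx> sub_P (sub_head x) * (sub_P (sub_head x) :: _ \<Rightarrow>\<^sub>0 'k)"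
      using relations.cong_sym[OF sub_P_sub_P[OF sub_head_verts sub_head_verts, of x x]] by simp
  qed
  also have "\<dots> = (\<Sum>x | x \<in> sub_arcs \<and> sub_tail x = a. sub_A x * sub_G x)"
    by (rule sum.cong) (auto simp: sub_A_def sub_G_def mult.assoc)
  finally show "sub_P a \<approx> (\<Sum>x | x \<in> sub_arcs \<and> sub_tail x = a. sub_A x * (sub_G x :: _ \<Rightarrow>\<^sub>0 'k))"
    using a(1) v by (simp add: sub_P_def part_def)
qed

section \<open>Words, degrees and action of the family\<close>

lemma rng_words: "rng v \<in> lpa_words E"
  unfolding rng_def by (intro words_over_sum words_over_mult gen_words) (auto dest: F_arc)

lemma sub_P_words: "sub_P a \<in> lpa_words E"
  using rng_words
  by (auto simp: sub_P_def part_def sub_verts_def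
      intro!: words_over_diff words_over_zero gen_words dest: Vs_vert)

lemma sub_A_words: "sub_A x \<in> lpa_words E"
  by (auto simp: sub_A_def sub_arcs_def
      intro!: words_over_mult words_over_zero gen_words sub_P_words dest: F_arc)

lemma sub_G_words: "sub_G x \<in> lpa_words E"
  by (auto simp: sub_G_def sub_arcs_def
      intro!: words_over_mult words_over_zero gen_words sub_P_words dest: F_arc)

lemma path_elt_words: "family.path_elt a es \<in> lpa_words E"
proof -
  have "y * prod_list (map sub_A es) \<in> lpa_words E" if "y \<in> lpa_words E" for y
    using that
  proof (induction es arbitrary: y)
    case (Cons e es)
    then have "y * sub_A e * prod_list (map sub_A es) \<in> lpa_words E"
      by (intro Cons.IH words_over_mult sub_A_words)
    then show ?case by (simp add: mult.assoc)
  qed simp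
  then show ?thesis unfolding family.path_elt_def using sub_P_words by blast
qed

lemma sub_P_homogeneous: "sub_P a \<in> homogeneous 0"
  by (auto simp: sub_P_def part_def rng_def word_mult
      intro!: homogeneous_diff homogeneous_zero homogeneous_sum homogeneous_single)

lemma sub_A_homogeneous: "sub_A x \<in> homogeneous 1"
  using homogeneous_mult[OF homogeneous_single sub_P_homogeneous, of "[Edge (fst x)]" 1 1]
  by (auto simp: sub_A_def homogeneous_zero)

lemma path_elt_homogeneous: "family.path_elt a es \<in> homogeneous (int (length es))"
proof -
  have "y * prod_list (map sub_A es) \<in> homogeneous (d + int (length es))"
    if "y \<in> homogeneous d" for y d
    using that
  proof (induction es arbitrary: y d)
    case (Cons e es)
    then have "y * sub_A e * prod_list (map sub_A es) \<in> homogeneous (d + 1 + int (length es))"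
      by (intro Cons.IH homogeneous_mult sub_A_homogeneous)
    then show ?case by (simp add: mult.assoc add.assoc)
  qed simp
  from this[OF sub_P_homogeneous] show ?thesis by (simp add: family.path_elt_def)
qed

text \<open>The part \<open>True\<close> fixes states whose point lies in the range of a chosen
  edge. The part \<open>False\<close> fixes those whose point avoids all these ranges; such a point
  lies in the range of an edge that is not chosen, or is arbitrary if \<open>v\<close> emits no
  edge.\<close>

lemma sub_P_act:
  assumes "a \<in> sub_verts"
  shows "\<exists>x. act (sub_P a) (\<lambda>y. if y = x then 1 else 0) x = 1"
proof -
  obtain v b where a: "a = (v, b)" by (cases a) auto
  have rng: "act (rng v) \<phi> (v, k, n) =
      (\<Sum>e | e \<in> F \<and> tail E e = v. if k \<in> range (enc e) then \<phi> (v, k, n) else 0)" for \<phi> k n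
    unfolding rng_def act_sum by (intro sum.cong) (auto simp: word_mult act_edge_ghost F_arc)
  show ?thesis
  proof (cases b)
    case True
    then obtain e where e: "e \<in> F" "tail E e = v" using assms a by (auto simp: sub_verts_def)
    have range: "enc e 0 \<in> range (enc f) \<longleftrightarrow> f = e" if "f \<in> F" "tail E f = v" for f
      using enc_disjoint[OF F_arc[OF e(1)] F_arc[OF that(1)], of "enc e 0"] e that by auto
    let ?x = "(v, enc e 0, 0)"
    have "act (rng v) (\<lambda>y. if y = ?x then 1 else 0) ?x =
        (\<Sum>f | f \<in> F \<and> tail E f = v. if f = e then 1 else 0)"
      unfolding rng by (intro sum.cong) (simp_all add: range)
    also have "\<dots> = 1" using e finite_F by simp
    finally show ?thesis using True assms a by (intro exI[of _ ?x]) (simp add: sub_P_def part_def)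
  next
    case False
    have "\<exists>k. \<forall>e\<in>F. tail E e = v \<longrightarrow> k \<notin> range (enc e)"
    proof (cases "out_arcs E v = {}")
      case True
      then have "\<not> (\<exists>e\<in>F. tail E e = v)" using F_arc by (auto simp: out_arcs_def)
      then show ?thesis by blast
    next
      case nonempty: False
      then have "\<not> out_arcs E v \<subseteq> F" using False assms a by (simp add: sub_verts_def)
      then obtain e where e: "e \<in> out_arcs E v" "e \<notin> F" by blast
      have "enc e 0 \<notin> range (enc f)" if "f \<in> F" "tail E f = v" for f
        using enc_disjoint[of e f "enc e 0"] F_arc[OF that(1)] e that by auto
      then show ?thesis by blast
    qed
    then obtain k where k: "\<forall>e\<in>F. tail E e = v \<longrightarrow> k \<notin> range (enc e)" by blast
    let ?x = "(v, k, 0)"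
    have "act (rng v) (\<lambda>y. if y = ?x then 1 else 0) ?x = 0"
      unfolding rng using k by (intro sum.neutral) auto
    then show ?thesis using False assms a
      by (intro exI[of _ ?x]) (simp add: sub_P_def part_def act_diff act_single)
  qed
qed

sublocale family: free_leavitt_family "relation_ideal :: (('v, 'e) lpa_gen list \<Rightarrow>\<^sub>0 'k) set"
  sub_verts sub_arcs sub_tail sub_head scalar sub_P sub_A sub_G
proof
  fix a and \<Gamma> :: "('e \<times> bool) list set" and c :: "('e \<times> bool) list \<Rightarrow> 'k"
  assume a: "a \<in> sub_verts" and \<Gamma>: "finite \<Gamma>" "[] \<in> \<Gamma>"
    and "(\<Sum>es\<in>\<Gamma>. scalar (c es) * family.path_elt a es) \<in> relation_ideal"
  then have ideal: "(\<Sum>es\<in>\<Gamma>. scalar (c es) * family.path_elt a es) \<in> lpa_ideal E"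
    by (intro iffD1[OF relation_ideal_iff] words_over_sum words_over_scalar path_elt_words)
  obtain x where x: "act (sub_P a) (\<lambda>y. if y = x then 1 else 0) x = (1 :: 'k)"
    using sub_P_act[OF a] by blast
  have "0 = (\<Sum>es\<in>\<Gamma>. c es * act (family.path_elt a es) (\<lambda>y. if y = x then 1 else 0) x)"
    using act_lpa_ideal[OF ideal] by (simp add: act_sum act_scalar)
  \<comment> \<open>Nonempty paths have positive degree and contribute nothing at \<open>x\<close>;
    the empty path is \<open>sub_P a\<close>, which contributes \<open>1\<close>.\<close>
  also have "\<dots> = (\<Sum>es\<in>\<Gamma>. if es = [] then c [] else 0)"
    using act_homogeneous[OF path_elt_homogeneous] x
    by (intro sum.cong) (auto simp: family.path_elt_def)
  also have "\<dots> = c []" using \<Gamma> by simp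
  finally show "c [] = 0" by simp
qed

section \<open>Tameness and the local unit for words in the subgraph\<close>

definition letters :: "('v, 'e) lpa_gen set" where
  "letters = Vertex ` Vs \<union> Edge ` F \<union> Ghost ` F"

lemma tame_sub_P: "family.tame 0 (sub_P a)"
  using family.tame_P family.tame_zero by (cases "a \<in> sub_verts") (auto simp: sub_P_def)

lemma tame_vx: "v \<in> Vs \<Longrightarrow> family.tame 0 (vx v)"
  by (rule family.tame_cong[OF family.tame_add relations.cong_sym[OF sub_P_sum]])
    (simp_all add: tame_sub_P)

text \<open>The edge is the sum of its two copies, and a copy outside \<open>sub_arcs\<close> is
  \<open>0\<close>.\<close>

lemma tame_ed:
  assumes "e \<in> F"
  shows "family.tame 0 (ed e)"
proof -
  have "ed e * sub_P (head E e, b) = (if (e, b) \<in> sub_arcs then sub_A (e, b) else 0)" for b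
    using assms by (auto simp: sub_A_def sub_head_def sub_arcs_def sub_P_def)
  then have tame: "family.tame 0 (ed e * sub_P (head E e, b))" for b
    using family.tame_A family.tame_zero by simp
  have "ed e \<approx> ed e * (vx (head E e) :: ('v, 'e) lpa_gen list \<Rightarrow>\<^sub>0 'k)"
    by (rule relations.cong_sym[OF ed_vx[OF F_arc[OF assms]]])
  also have "\<dots> \<approx> ed e * (sub_P (head E e, True) + sub_P (head E e, False))"
    by (rule relations.cong_left[OF relations.cong_sym[OF sub_P_sum[OF head_Vs[OF assms]]]])
  finally have "ed e \<approx> ed e * sub_P (head E e, True) + ed e * sub_P (head E e, False)"
    by (simp only: distrib_left)
  then show ?thesis by (rule family.tame_cong[OF family.tame_add[OF tame tame]])
qed

lemma tame_gh:
  assumes "e \<in> F"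
  shows "family.tame 1 (gh e)"
proof -
  have "sub_P (head E e, b) * gh e = (if (e, b) \<in> sub_arcs then sub_G (e, b) else 0)" for b
    using assms by (auto simp: sub_G_def sub_head_def sub_arcs_def sub_P_def)
  then have tame: "family.tame 1 (sub_P (head E e, b) * gh e)" for b
    using family.tame_G family.tame_zero by simp
  have "gh e \<approx> (vx (head E e) :: ('v, 'e) lpa_gen list \<Rightarrow>\<^sub>0 'k) * gh e"
    by (rule relations.cong_sym[OF vx_gh[OF F_arc[OF assms]]])
  also have "\<dots> \<approx> (sub_P (head E e, True) + sub_P (head E e, False)) * gh e"
    by (rule relations.cong_right[OF relations.cong_sym[OF sub_P_sum[OF head_Vs[OF assms]]]])
  finally have "gh e \<approx> sub_P (head E e, True) * gh e + sub_P (head E e, False) * gh e"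
    by (simp only: distrib_right)
  then show ?thesis by (rule family.tame_cong[OF family.tame_add[OF tame tame]])
qed

lemma tame_word: "set w \<subseteq> letters \<Longrightarrow> \<exists>N. family.tame N (word w)"
proof (induction w)
  case Nil
  show ?case
    by (intro exI[of _ 0]) (auto simp: family.tame_def scalar_one intro: family.path_span_path)
next
  case (Cons g w)
  then obtain N where N: "family.tame N (word w)" by auto
  have "\<exists>M. family.tame M (word [g])"
    using Cons.prems tame_vx tame_ed tame_gh by (auto simp: letters_def)
  then obtain M where "family.tame M (word [g])" by blast
  from family.tame_mult[OF this N] show ?case by (auto simp: word_mult)
qed

lemma tame_words_over:
  assumes "p \<in> words_over letters"
  shows "\<exists>N. family.tame N p"
proof -
  have "\<exists>N. family.tame N (\<Sum>w\<in>W. single w (lookup p w))" if "finite W" "W \<subseteq> keys p" for W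
    using that
  proof (induction W rule: finite_induct)
    case empty
    then show ?case using family.tame_zero by auto
  next
    case (insert w W)
    then obtain M where M: "family.tame M (\<Sum>w\<in>W. single w (lookup p w))" by auto
    have "set w \<subseteq> letters" using insert assms by (auto simp: words_over_def)
    then obtain N where "family.tame N (word w)" using tame_word by blast
    then have N: "family.tame N (single w (lookup p w))"
      using family.tame_scalar[of N "word w" "lookup p w"] by (simp add: word_mult)
    have "family.tame (max N M) (single w (lookup p w) + (\<Sum>w\<in>W. single w (lookup p w)))"
      by (intro family.tame_add family.tame_mono[OF N] family.tame_mono[OF M]) simp_all
    then show ?case using insert by auto
  qed
  from this[of "keys p"] show ?thesis using poly_mapping_sum_single[of p] by simp
qed

lemma unit_eq: "family.unit \<approx> (\<Sum>v\<in>Vs. vx v)"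
proof -
  have "family.unit = (\<Sum>x\<in>Vs \<times> UNIV. sub_P x)"
    unfolding family.unit_def using finite_Vs
    by (intro sum.mono_neutral_left) (auto simp: sub_verts_def sub_P_def)
  also have "\<dots> = (\<Sum>v\<in>Vs. \<Sum>b\<in>UNIV. sub_P (v, b))"
    by (simp add: sum.cartesian_product)
  also have "\<dots> = (\<Sum>v\<in>Vs. sub_P (v, True) + sub_P (v, False))"
    by (simp add: UNIV_bool add.commute)
  also have "\<dots> \<approx> (\<Sum>v\<in>Vs. vx v)" by (intro relations.cong_sum sub_P_sum)
  finally show ?thesis .
qed

lemma unit_vx:
  assumes "w \<in> Vs"
  shows "family.unit * vx w \<approx> vx w" "vx w * family.unit \<approx> vx w"
proof -
  have "family.unit * vx w \<approx> (\<Sum>v\<in>Vs. vx v * vx w)"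
    using relations.cong_right[OF unit_eq] by (simp add: sum_distrib_right)
  also have "\<dots> \<approx> (\<Sum>v\<in>Vs. if v = w then vx v else 0)"
    by (intro relations.cong_sum vx_vx Vs_vert assms)
  also have "\<dots> = vx w" using assms finite_Vs by simp
  finally show "family.unit * vx w \<approx> vx w" .
  have "vx w * family.unit \<approx> (\<Sum>v\<in>Vs. vx w * vx v)"
    using relations.cong_left[OF unit_eq] by (simp add: sum_distrib_left)
  also have "\<dots> \<approx> (\<Sum>v\<in>Vs. if w = v then vx w else 0)"
    by (intro relations.cong_sum vx_vx Vs_vert assms)
  also have "\<dots> = vx w" using assms finite_Vs by simp
  finally show "vx w * family.unit \<approx> vx w" .
qed

lemma unit_left:
  assumes "w \<in> Vs" "vx w * x \<approx> x"
  shows "family.unit * x \<approx> x"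
proof -
  have "family.unit * x \<approx> family.unit * vx w * x"
    using relations.cong_left[OF relations.cong_sym[OF assms(2)]] by (simp add: mult.assoc)
  also have "\<dots> \<approx> vx w * x" by (rule relations.cong_right[OF unit_vx(1)[OF assms(1)]])
  also note assms(2)
  finally show ?thesis .
qed

lemma unit_right:
  assumes "w \<in> Vs" "x * vx w \<approx> x"
  shows "x * family.unit \<approx> x"
proof -
  have "x * family.unit \<approx> x * (vx w * family.unit)"
    using relations.cong_right[OF relations.cong_sym[OF assms(2)]] by (simp add: mult.assoc)
  also have "\<dots> \<approx> x * vx w" by (rule relations.cong_left[OF unit_vx(2)[OF assms(1)]])
  also note assms(2)
  finally show ?thesis .
qed

lemma unit_letter:
  assumes "g \<in> letters"
  shows "family.unit * word [g] \<approx> word [g]" "word [g] * family.unit \<approx> word [g]"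
  using assms unfolding letters_def
  by (auto intro: unit_left unit_right unit_vx tail_Vs head_Vs vx_ed ed_vx vx_gh gh_vx dest: F_arc)

lemma unit_words_over:
  assumes "p \<in> words_over letters"
  shows "family.unit * p \<approx> p" "p * family.unit \<approx> p"
proof -
  have word: "family.unit * single w c \<approx> single w c \<and> single w c * family.unit \<approx> single w c"
    if w: "w \<noteq> []" "set w \<subseteq> letters" for w c
  proof
    obtain g w' where g: "w = g # w'" using w(1) by (cases w) auto
    have "single w c = word [g] * single w' c" by (simp add: word_mult g)
    then show "family.unit * single w c \<approx> single w c"
      using relations.cong_right[OF unit_letter(1)[of g], of "single w' c"] w g
      by (simp add: mult.assoc)
    obtain h w'' where h: "w = w'' @ [h]" using w(1) by (cases w rule: rev_cases) auto
    have "single w c = single w'' c * word [h]" by (simp add: word_mult h)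
    then show "single w c * family.unit \<approx> single w c"
      using relations.cong_left[OF unit_letter(2)[of h], of "single w'' c"] w h
      by (simp add: mult.assoc)
  qed
  have p: "p = (\<Sum>w\<in>keys p. single w (lookup p w))" by (rule poly_mapping_sum_single)
  have "(\<Sum>w\<in>keys p. family.unit * single w (lookup p w)) \<approx> (\<Sum>w\<in>keys p. single w (lookup p w))"
    "(\<Sum>w\<in>keys p. single w (lookup p w) * family.unit) \<approx> (\<Sum>w\<in>keys p. single w (lookup p w))"
    using assms word by (auto intro!: relations.cong_sum simp: words_over_def)
  then show "family.unit * p \<approx> p" "p * family.unit \<approx> p"
    by (simp_all add: sum_distrib_left[symmetric] sum_distrib_right[symmetric] p[symmetric])
qed

end

text \<open>Every relation in a Leavitt path algebra takes place in a finite subgraph.\<close>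

theorem lpa_flatness:
  fixes a r :: "'i \<Rightarrow> ('v, 'e) lpa_gen list \<Rightarrow>\<^sub>0 'k::field"
  assumes "countable_digraph E" and I: "finite I"
    and words: "\<And>i. i \<in> I \<Longrightarrow> a i \<in> lpa_words E" "\<And>i. i \<in> I \<Longrightarrow> r i \<in> lpa_words E"
    and relation: "(\<Sum>i\<in>I. a i * r i) \<in> lpa_ideal E"
  obtains T where "\<forall>j i. T j i \<in> lpa_words E"
    "\<forall>i\<in>I. a i - (\<Sum>j\<in>I. a j * T j i) \<in> lpa_ideal E"
    "\<forall>j\<in>I. (\<Sum>i\<in>I. T j i * r i) \<in> lpa_ideal E"
proof -
  interpret countable_digraph E by fact
  define S where "S = (\<Union>i\<in>I. \<Union>w\<in>keys (a i) \<union> keys (r i). set w)"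
  have "finite S" using I by (auto simp: S_def)
  have "S \<subseteq> lpa_gens E" using words by (fastforce simp: S_def words_over_def)
  \<comment> \<open>An edge is chosen if it or its ghost occurs; the end points of chosen edges are
    then added to the vertices.\<close>
  define F where "F = {e. Edge e \<in> S \<or> Ghost e \<in> S}"
  define Vs where "Vs = {v. Vertex v \<in> S} \<union> tail E ` F \<union> head E ` F"
  have "finite (Edge -` S \<union> Ghost -` S)" "finite (Vertex -` S)"
    using \<open>finite S\<close> by (auto intro!: finite_vimageI simp: inj_def)
  then have "finite F" "finite {v. Vertex v \<in> S}" by (auto simp: F_def vimage_def Collect_disj_eq)
  then interpret finite_subgraph E Vs F "TYPE('k)"
    using \<open>S \<subseteq> lpa_gens E\<close> by unfold_locales (auto simp: Vs_def F_def lpa_gens_def)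
  have "S \<subseteq> letters"
  proof
    fix g assume "g \<in> S"
    then show "g \<in> letters" unfolding letters_def by (cases g) (auto simp: Vs_def F_def)
  qed
  then have aL: "a i \<in> words_over letters" and rL: "r i \<in> words_over letters" if "i \<in> I" for i
    using words that by (fastforce simp: S_def words_over_def)+
  obtain T where T: "\<And>j i. T j i \<in> lpa_words E"
    "\<And>i. i \<in> I \<Longrightarrow> relations.cong (a i) (\<Sum>j\<in>I. a j * T j i)"
    "\<And>j. j \<in> I \<Longrightarrow> (\<Sum>i\<in>I. T j i * r i) \<in> relation_ideal"
  proof (rule family.flatness[of "lpa_words E" I a r])
    show "(\<Sum>i\<in>I. a i * r i) \<in> relation_ideal" by (rule lpa_ideal_relation_ideal[OF relation])
  qed (use I aL rL in \<open>auto intro: words_over_add words_over_zero words_over_mult words_over_scalar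
      sub_P_words sub_A_words sub_G_words tame_words_over unit_words_over\<close>)
  show thesis
  proof (rule that[of T]; intro allI ballI)
    show "T j i \<in> lpa_words E" for j i by (rule T)
    show "a i - (\<Sum>j\<in>I. a j * T j i) \<in> lpa_ideal E" if "i \<in> I" for i
    proof -
      have "a i - (\<Sum>j\<in>I. a j * T j i) \<in> lpa_words E"
        using that words T(1) by (intro words_over_diff words_over_sum words_over_mult)
      then show ?thesis using T(2)[OF that] unfolding relations.cong_def
        by (rule iffD1[OF relation_ideal_iff])
    qed
    show "(\<Sum>i\<in>I. T j i * r i) \<in> lpa_ideal E" if "j \<in> I" for j
    proof -
      have "(\<Sum>i\<in>I. T j i * r i) \<in> lpa_words E"
        using words T(1) by (intro words_over_sum words_over_mult)
      then show ?thesis using T(3)[OF that] by (rule iffD1[OF relation_ideal_iff])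
    qed
  qed
qed

section \<open>Products of ideals\<close>

context wf_digraph
begin

definition cls :: "(('a, 'b) lpa_gen list \<Rightarrow>\<^sub>0 'k::field) \<Rightarrow> (('a, 'b) lpa_gen list \<Rightarrow>\<^sub>0 'k) set" where
  "cls p = lpa_ideal G +>\<^bsub>free_algebra (lpa_gens G)\<^esub> p"

lemma mem_cls: "q \<in> cls p \<longleftrightarrow> q - p \<in> lpa_ideal G"
  unfolding cls_def a_r_coset_def' by (auto intro!: bexI[of _ "q - p"])

lemma cls_eq_iff: "cls p = cls q \<longleftrightarrow> p - q \<in> lpa_ideal G"
proof
  assume "cls p = cls q"
  moreover have "p \<in> cls p" using lpa_ideal_closed by (auto simp: mem_cls)
  ultimately show "p - q \<in> lpa_ideal G" by (simp add: mem_cls)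
next
  assume pq: "p - q \<in> lpa_ideal G"
  show "cls p = cls q"
  proof (rule Set.set_eqI)
    fix x
    have "x - p \<in> lpa_ideal G \<longleftrightarrow> x - q \<in> lpa_ideal G"
      using lpa_ideal_diff[OF _ pq, of "x - q"] lpa_ideal_add[OF _ pq, of "x - p"] by auto
    then show "x \<in> cls p \<longleftrightarrow> x \<in> cls q" by (simp add: mem_cls)
  qed
qed

section \<open>The operations of \<open>L\<close> on representatives\<close>

lemma carrier_lpa: "carrier (leavitt_path_algebra G) = cls ` lpa_words G"
  unfolding leavitt_path_algebra_def quotient_algebra_def
  by (auto simp: ring.extend_def FactRing_def A_RCOSETS_def' cls_def lpa_ideal_def)

lemma zero_lpa: "\<zero>\<^bsub>leavitt_path_algebra G\<^esub> = cls 0"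
  by (rule Set.set_eqI) (simp add: leavitt_path_algebra_def quotient_algebra_def ring.extend_def
      FactRing_def lpa_ideal_def[symmetric] mem_cls)

lemma add_lpa:
  "cls p \<oplus>\<^bsub>leavitt_path_algebra G\<^esub> cls q = cls (p + q)"
proof -
  have "cls p \<oplus>\<^bsub>leavitt_path_algebra G\<^esub> cls q = {a + b | a b. a \<in> cls p \<and> b \<in> cls q}"
    unfolding leavitt_path_algebra_def quotient_algebra_def
    by (auto simp: ring.extend_def FactRing_def set_add_def')
  also have "\<dots> = cls (p + q)"
  proof (intro Set.set_eqI iffI)
    fix x assume "x \<in> {a + b | a b. a \<in> cls p \<and> b \<in> cls q}"
    then obtain a b where "x = a + b" "a - p \<in> lpa_ideal G" "b - q \<in> lpa_ideal G"
      by (auto simp: mem_cls)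
    moreover from this have "(a - p) + (b - q) \<in> lpa_ideal G" using lpa_ideal_closed by blast
    ultimately show "x \<in> cls (p + q)" by (simp add: mem_cls algebra_simps)
  next
    fix x assume "x \<in> cls (p + q)"
    then have "x - q \<in> cls p" "q \<in> cls q" "x = (x - q) + q"
      using lpa_ideal_closed by (auto simp: mem_cls algebra_simps)
    then show "x \<in> {a + b | a b. a \<in> cls p \<and> b \<in> cls q}" by blast
  qed
  finally show ?thesis .
qed

lemma mult_lpa:
  assumes p: "p \<in> lpa_words G" and q: "q \<in> lpa_words G"
  shows "cls p \<otimes>\<^bsub>leavitt_path_algebra G\<^esub> cls q = cls (p * q)"
proof -
  have "cls p \<otimes>\<^bsub>leavitt_path_algebra G\<^esub> cls q = (\<Union>a\<in>cls p. \<Union>b\<in>cls q. cls (a * b))"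
    unfolding leavitt_path_algebra_def quotient_algebra_def
    by (simp add: ring.extend_def FactRing_def rcoset_mult_def cls_def lpa_ideal_def)
  \<comment> \<open>All cosets in the union agree, because \<open>a * b - p * q\<close> is the sum
    of \<open>(a - p) * b\<close> and \<open>p * (b - q)\<close>.\<close>
  also have "\<dots> = (\<Union>a\<in>cls p. \<Union>b\<in>cls q. cls (p * q))"
  proof (intro SUP_cong refl)
    fix a b assume "a \<in> cls p" "b \<in> cls q"
    then have ab: "a - p \<in> lpa_ideal G" "b - q \<in> lpa_ideal G" by (simp_all add: mem_cls)
    then have "b \<in> lpa_words G"
      using words_over_add[OF lpa_ideal_words[OF ab(2)] q] by simp
    then have "(a - p) * b \<in> lpa_ideal G" "p * (b - q) \<in> lpa_ideal G"
      using ab p lpa_ideal_closed by blast+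
    then have "(a - p) * b + p * (b - q) \<in> lpa_ideal G" using lpa_ideal_closed by blast
    then show "cls (a * b) = cls (p * q)" by (simp add: cls_eq_iff algebra_simps)
  qed
  also have "\<dots> = cls (p * q)"
  proof -
    have "p \<in> cls p" "q \<in> cls q" using lpa_ideal_closed by (auto simp: mem_cls)
    then show ?thesis by blast
  qed
  finally show ?thesis .
qed

context
  fixes A :: "(('a, 'b) lpa_gen list \<Rightarrow>\<^sub>0 'k::field) set set"
  assumes A: "two_sided_ideal A (leavitt_path_algebra G)"
begin

lemma ideal_cases:
  assumes "x \<in> A"
  obtains p where "p \<in> lpa_words G" "x = cls p"
proof -
  have "A \<subseteq> carrier (leavitt_path_algebra G)"
    using A unfolding two_sided_ideal_def by (intro additive_subgroup.a_subset) (rule conjunct1)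
  then have "x \<in> cls ` lpa_words G" using assms unfolding carrier_lpa by (rule subsetD)
  then show ?thesis using that by (elim imageE)
qed

lemma ideal_zero: "cls 0 \<in> A"
  using A additive_subgroup.zero_closed[of A "leavitt_path_algebra G"]
  unfolding two_sided_ideal_def by (simp add: zero_lpa)

lemma ideal_add: "cls p \<in> A \<Longrightarrow> cls q \<in> A \<Longrightarrow> cls (p + q) \<in> A"
  using A additive_subgroup.a_closed[of A "leavitt_path_algebra G" "cls p" "cls q"]
  unfolding two_sided_ideal_def by (simp add: add_lpa)

lemma ideal_left_mult:
  assumes "p \<in> lpa_words G" "q \<in> lpa_words G" "cls q \<in> A"
  shows "cls (p * q) \<in> A"
  using assms A carrier_lpa mult_lpa[OF assms(1,2)] unfolding two_sided_ideal_def by (metis imageI)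

lemma ideal_sum:
  assumes "finite I" "\<And>i. i \<in> I \<Longrightarrow> p i \<in> lpa_words G" "\<And>i. i \<in> I \<Longrightarrow> q i \<in> lpa_words G"
    "\<And>i. i \<in> I \<Longrightarrow> cls (q i) \<in> A"
  shows "cls (\<Sum>i\<in>I. p i * q i) \<in> A"
  using assms by (induction I rule: finite_induct) (auto intro!: ideal_zero ideal_add ideal_left_mult)

end

text \<open>\<open>ideal_prod\<close> is closed inductively under sums; a single indexed sum is the
  form to which the matrix argument applies.\<close>

lemma ideal_prod_cases:
  assumes A: "two_sided_ideal A (leavitt_path_algebra G)"
    and B: "two_sided_ideal B (leavitt_path_algebra G)"
    and x: "x \<in> ideal_prod (leavitt_path_algebra G) A B"
  obtains n a b where "\<forall>i<n. a i \<in> lpa_words G \<and> cls (a i) \<in> A"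
    "\<forall>i<n. b i \<in> lpa_words G \<and> cls (b i) \<in> B" "x = cls (\<Sum>i<(n::nat). a i * b i)"
proof -
  define Z where "Z = {(p, q). p \<in> lpa_words G \<and> cls p \<in> A \<and> q \<in> lpa_words G \<and> cls q \<in> B}"
  have "\<exists>zs. set zs \<subseteq> Z \<and> x = cls (\<Sum>(p, q)\<leftarrow>zs. p * q)"
    using x
  proof (induction rule: ideal_prod.induct)
    case (prod i j)
    obtain p q where "p \<in> lpa_words G" "i = cls p" "q \<in> lpa_words G" "j = cls q"
      using ideal_cases[OF A prod(1)] ideal_cases[OF B prod(2)] by metis
    then show ?case using prod by (intro exI[of _ "[(p, q)]"]) (simp add: Z_def mult_lpa)
  next
    case (sum x y)
    then obtain us vs where "set us \<subseteq> Z" "x = cls (\<Sum>(p, q)\<leftarrow>us. p * q)"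
      "set vs \<subseteq> Z" "y = cls (\<Sum>(p, q)\<leftarrow>vs. p * q)" by blast
    then show ?case by (intro exI[of _ "us @ vs"]) (simp add: add_lpa)
  qed
  then obtain zs where zs: "set zs \<subseteq> Z" "x = cls (\<Sum>(p, q)\<leftarrow>zs. p * q)" by blast
  have mem: "zs ! i \<in> Z" if "i < length zs" for i using zs(1) that nth_mem by blast
  show ?thesis
  proof (rule that[of "length zs" "\<lambda>i. fst (zs ! i)" "\<lambda>i. snd (zs ! i)"])
    show "x = cls (\<Sum>i<length zs. fst (zs ! i) * snd (zs ! i))"
      unfolding zs(2) by (simp add: sum_list_sum_nth split_def atLeast0LessThan)
  qed (use mem in \<open>auto simp: Z_def split_def\<close>)
qed

text \<open>\<open>D\<close> stands for an intersection of ideals. The empty sum is obtained as the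
  product of two zero classes.\<close>

lemma ideal_prod_sum:
  assumes A: "two_sided_ideal A (leavitt_path_algebra G)" and D: "cls 0 \<in> D"
    and "finite I" "\<And>i. i \<in> I \<Longrightarrow> p i \<in> lpa_words G \<and> cls (p i) \<in> A"
    "\<And>i. i \<in> I \<Longrightarrow> q i \<in> lpa_words G \<and> cls (q i) \<in> D"
  shows "cls (\<Sum>i\<in>I. p i * q i) \<in> ideal_prod (leavitt_path_algebra G) A D"
  using assms(3-)
proof (induction I rule: finite_induct)
  case empty
  show ?case
    using ideal_prod.prod[of "cls 0" A "cls 0" D "leavitt_path_algebra G"] ideal_zero[OF A] D
    by (simp add: mult_lpa words_over_zero)
next
  case (insert i I)
  have "cls (p i) \<otimes>\<^bsub>leavitt_path_algebra G\<^esub> cls (q i) \<in> ideal_prod (leavitt_path_algebra G) A D"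
    using insert by (intro ideal_prod.prod) auto
  then have "cls (p i * q i) \<in> ideal_prod (leavitt_path_algebra G) A D"
    using insert mult_lpa[of "p i" "q i"] by simp
  from ideal_prod.sum[OF this insert.IH] show ?case using insert by (simp add: add_lpa)
qed

end

lemma ideal_prod_mono: "B \<subseteq> C \<Longrightarrow> ideal_prod R A B \<subseteq> ideal_prod R A C"
proof
  fix x assume BC: "B \<subseteq> C" and "x \<in> ideal_prod R A B"
  from this(2) show "x \<in> ideal_prod R A C"
    by (induction rule: ideal_prod.induct) (use BC in \<open>auto intro: ideal_prod.intros\<close>)
qed

theorem theorem6:
  fixes E :: "('v, 'e) pre_digraph"
    and L :: "('k::field, (('v, 'e) lpa_gen list \<Rightarrow>\<^sub>0 'k) set) module"
  assumes "countable_digraph E"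
    and "L = leavitt_path_algebra E"
    and "two_sided_ideal A L" and "two_sided_ideal B L" and "two_sided_ideal C L"
  shows "ideal_prod L A (B \<inter> C) = ideal_prod L A B \<inter> ideal_prod L A C"
proof
  show "ideal_prod L A (B \<inter> C) \<subseteq> ideal_prod L A B \<inter> ideal_prod L A C"
    using ideal_prod_mono[of "B \<inter> C"] by blast
next
  interpret countable_digraph E by fact
  note A = assms(3)[unfolded assms(2)] and B = assms(4)[unfolded assms(2)]
    and C = assms(5)[unfolded assms(2)]
  show "ideal_prod L A B \<inter> ideal_prod L A C \<subseteq> ideal_prod L A (B \<inter> C)"
    unfolding assms(2)
  proof
    fix x assume x: "x \<in> ideal_prod (leavitt_path_algebra E) A B \<inter> ideal_prod (leavitt_path_algebra E) A C"
    obtain m a b where ab: "\<forall>i<m. a i \<in> lpa_words E \<and> cls (a i) \<in> A"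
      "\<forall>i<m. b i \<in> lpa_words E \<and> cls (b i) \<in> B" "x = cls (\<Sum>i<(m::nat). a i * b i)"
      using ideal_prod_cases[OF A B IntD1[OF x]] .
    obtain n a' c where ac: "\<forall>i<n. a' i \<in> lpa_words E \<and> cls (a' i) \<in> A"
      "\<forall>i<n. c i \<in> lpa_words E \<and> cls (c i) \<in> C" "x = cls (\<Sum>i<(n::nat). a' i * c i)"
      using ideal_prod_cases[OF A C IntD2[OF x]] .
    define I where "I = {..<m} <+> {..<n}"
    define p where "p = case_sum a a'"
    define r where "r = case_sum b (\<lambda>i. - c i)"
    have I: "finite I" by (simp add: I_def)
    have p: "p i \<in> lpa_words E \<and> cls (p i) \<in> A" and r: "r i \<in> lpa_words E" if "i \<in> I" for i
      using that ab(1,2) ac(1,2) by (auto simp: I_def p_def r_def words_over_uminus)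
    have split: "(\<Sum>i\<in>I. f i) = (\<Sum>i<m. f (Inl i)) + (\<Sum>i<n. f (Inr i))"
      for f :: "nat + nat \<Rightarrow> ('v, 'e) lpa_gen list \<Rightarrow>\<^sub>0 'k"
      by (simp add: I_def sum.Plus)
    have relation: "(\<Sum>i\<in>I. p i * r i) \<in> lpa_ideal E"
      using trans[OF sym[OF ab(3)] ac(3)] unfolding split
      by (simp add: p_def r_def sum_negf cls_eq_iff)
    obtain T where T_all: "\<forall>j i. T j i \<in> lpa_words E"
      "\<forall>i\<in>I. p i - (\<Sum>j\<in>I. p j * T j i) \<in> lpa_ideal E"
      "\<forall>j\<in>I. (\<Sum>i\<in>I. T j i * r i) \<in> lpa_ideal E"
      by (rule lpa_flatness[OF assms(1) I conjunct1[OF p] r relation])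
    note T = T_all[rule_format]
    define y where "y j = (\<Sum>i<m. T j (Inl i) * b i)" for j
    have y_words: "y j \<in> lpa_words E" for j
      unfolding y_def using T(1) ab(2) by (intro words_over_sum words_over_mult) auto
    have y_B: "cls (y j) \<in> B" for j
      unfolding y_def using T(1) ab(2) by (intro ideal_sum[OF B]) auto
    have y_C: "cls (y j) \<in> C" if "j \<in> I" for j
    proof -
      have "y j - (\<Sum>i<n. T j (Inr i) * c i) \<in> lpa_ideal E"
        using T(3)[OF that] unfolding split by (simp add: r_def y_def sum_negf)
      then have "cls (y j) = cls (\<Sum>i<n. T j (Inr i) * c i)" by (simp add: cls_eq_iff)
      also have "\<dots> \<in> C" using T(1) ac(2) by (intro ideal_sum[OF C]) auto
      finally show ?thesis .
    qed
    \<comment> \<open>Only the columns \<open>Inl i\<close> of the identity \<open>p T = p\<close>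
      enter, as \<open>y\<close> is built from the \<open>b i\<close>.\<close>
    have "(\<Sum>i<m. a i * b i) - (\<Sum>j\<in>I. p j * y j) \<in> lpa_ideal E"
    proof -
      have "(\<Sum>j\<in>I. p j * y j) = (\<Sum>i<m. (\<Sum>j\<in>I. p j * T j (Inl i)) * b i)"
        unfolding y_def sum_distrib_left sum_distrib_right mult.assoc by (rule sum.swap)
      then have "(\<Sum>i<m. a i * b i) - (\<Sum>j\<in>I. p j * y j) =
          (\<Sum>i<m. (p (Inl i) - (\<Sum>j\<in>I. p j * T j (Inl i))) * b i)"
        by (simp add: p_def left_diff_distrib sum_subtractf)
      also have "\<dots> \<in> lpa_ideal E"
      proof (rule lpa_ideal_sum)
        fix i assume "i \<in> {..<m}"
        then have "Inl i \<in> I" "b i \<in> lpa_words E" using ab(2) by (auto simp: I_def)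
        then show "(p (Inl i) - (\<Sum>j\<in>I. p j * T j (Inl i))) * b i \<in> lpa_ideal E"
          using T(2) lpa_ideal_closed by blast
      qed
      finally show ?thesis .
    qed
    then have "x = cls (\<Sum>j\<in>I. p j * y j)" by (simp add: ab(3) cls_eq_iff)
    also have "\<dots> \<in> ideal_prod (leavitt_path_algebra E) A (B \<inter> C)"
      using p y_words y_B y_C I ideal_zero[OF B] ideal_zero[OF C] by (intro ideal_prod_sum A) auto
    finally show "x \<in> ideal_prod (leavitt_path_algebra E) A (B \<inter> C)" .
  qed
qed

end
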